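(* Let $\mathcal{G}$ be a directed graph with $n$ vertices, $m$ edges and incidence matrix $B\in\mathbb{R}^{n\times m}$, and let $u^-,u^+\in\mathbb{R}^m$ be constraint vectors compatible with the orientation of $\mathcal{G}$. Let $H:\mathbb{R}^n\to\mathbb{R}$ be a strictly convex, twice differentiable function with positive definite Hessian at every point, reaching its minimum at the origin. For any desired state $x^*$ in the admissible set $\mathcal{A}=\{x\in\mathbb{R}^n\mid \mathds{1}^Tx=\mathds{1}^Tx(0)\}$, write $\tilde x = x-x^*$ (so that $\mathds{1}^T\tilde x(0)=0$) and consider the dynamical system with state $(\tilde x,x_c)\in\mathbb{R}^n\times\mathbb{R}^m$ $$\dot{\tilde{x}} = B\,\mathrm{sat}\Big(-B^T\frac{\partial H}{\partial \tilde{x}}(\tilde{x})-x_c\,;u^-,u^+\Big),\qquad \dot{x}_c = B^T\frac{\partial H}{\partial \tilde{x}}(\tilde{x}).$$ Then the trajectories $(\tilde x(t),x_c(t))$ (with $\mathds{1}^T\tilde x(0)=0$ and arbitrary $x_c(0)\in\mathbb{R}^m$) converge, as $t\to\infty$, into $$\mathcal{E}_{\mathrm{tot}} = \{ (0,x_c) \mid x_c\in\mathbb{R}^m,\ B\,\mathrm{sat}(-x_c\,;u^-,u^+) = 0 \}$$ if and only if the graph $\mathcal{G}$ with constraints $[u^-,u^+]$ satisfies the interior point condition.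
   Context: A directed graph $\mathcal{G}$ consists of a finite vertex set $\mathcal{V}$ (with $n$ elements), a finite edge set $\mathcal{E}$ (with $m$ elements), and a map from $\mathcal{E}$ to ordered pairs $(v,w)$ of distinct vertices (tail $v$, head $w$); self-loops are not allowed. Its incidence matrix $B$ is the $n\times m$ matrix whose $(i,j)$ entry is $1$ if edge $j$ points towards vertex $i$, $-1$ if edge $j$ originates from vertex $i$, and $0$ otherwise. $\mathcal{G}^o$ is the undirected graph obtained by ignoring orientations. A spanning tree is a connected acyclic subgraph of $\mathcal{G}^o$ containing all vertices. $\mathds{1}$ is the vector with all entries $1$, and $\frac{\partial H}{\partial \tilde x}$ is the column vector of partial derivatives of $H$. For $a,b\in\mathbb{R}^m$ with $a_i\le b_i$ for all $i$, the saturation $\mathrm{sat}(\cdot\,;a,b):\mathbb{R}^m\to\mathbb{R}^m$ is defined componentwise by $\mathrm{sat}(x;a,b)_i=a_i$ if $x_i<a_i$, $=x_i$ if $a_i\le x_i\le b_i$, $=b_i$ if $x_i>b_i$. $[u^-,u^+]$ denotes $\{z\in\mathbb{R}^m: u^-_i\le z_i\le u^+_i \ \forall i\}$. Compatible constraints: $u^+_i\ge u^-_i\ge 0$ for all $i=1,\dots,m$, where for each $i$ the two equalities do not hold at the same time. Interior point condition: there exists a vector $z\in[u^-,u^+]$ such that $B\,\mathrm{sat}(z;u^-,u^+)=Bz=0$, and the set of edges $e_i$ for which $z_i$ is an interior point of the interval $[u^-_i,u^+_i]$ contains a spanning tree. Convergence of a trajectory into a set means that its distance to the set tends to $0$ as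 $t\to\infty$. *)

theory Defs
  imports "HOL-Analysis.Analysis"
begin

text \<open>
  A directed graph is given by a finite vertex type, a finite edge type and two maps \<open>tail\<close> and
  \<open>head\<close>; parallel edges are allowed. Vectors indexed by vertices or edges then live in
  \<open>real^'v\<close> and \<open>real^'e\<close>.
\<close>

definition directed_graph :: "('e::finite \<Rightarrow> 'v::finite) \<Rightarrow> ('e \<Rightarrow> 'v) \<Rightarrow> bool" where
  "directed_graph tail head \<longleftrightarrow> (\<forall>e. tail e \<noteq> head e)"

definition incidence_matrix :: "('e::finite \<Rightarrow> 'v::finite) \<Rightarrow> ('e \<Rightarrow> 'v) \<Rightarrow> real^'e^'v" where
  "incidence_matrix tail head =
     (\<chi> i j. if head j = i then 1 else if tail j = i then - 1 else 0)"

text \<open>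
  Spanning trees refer to the undirected multigraph underlying the directed one. Two parallel
  edges form a cycle of length two.
\<close>

definition joins :: "('e \<Rightarrow> 'v) \<Rightarrow> ('e \<Rightarrow> 'v) \<Rightarrow> 'e \<Rightarrow> 'v \<Rightarrow> 'v \<Rightarrow> bool" where
  "joins tail head e v w \<longleftrightarrow> (tail e = v \<and> head e = w) \<or> (tail e = w \<and> head e = v)"

definition undirected_connected :: "('e \<Rightarrow> 'v) \<Rightarrow> ('e \<Rightarrow> 'v) \<Rightarrow> 'e set \<Rightarrow> bool" where
  "undirected_connected tail head T \<longleftrightarrow>
     (\<forall>v w. (v, w) \<in> {(a, b). \<exists>e\<in>T. joins tail head e a b}\<^sup>*)"

definition undirected_cycle ::
    "('e \<Rightarrow> 'v) \<Rightarrow> ('e \<Rightarrow> 'v) \<Rightarrow> 'v list \<Rightarrow> 'e list \<Rightarrow> bool" where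
  "undirected_cycle tail head vs es \<longleftrightarrow>
     es \<noteq> [] \<and> length vs = length es \<and> distinct vs \<and> distinct es \<and>
     (\<forall>i<length es. joins tail head (es ! i) (vs ! i) (vs ! (Suc i mod length es)))"

definition spanning_tree :: "('e \<Rightarrow> 'v) \<Rightarrow> ('e \<Rightarrow> 'v) \<Rightarrow> 'e set \<Rightarrow> bool" where
  "spanning_tree tail head T \<longleftrightarrow>
     undirected_connected tail head T \<and>
     \<not> (\<exists>vs es. set es \<subseteq> T \<and> undirected_cycle tail head vs es)"

definition sat :: "real^'e \<Rightarrow> real^'e \<Rightarrow> real^'e \<Rightarrow> real^'e::finite" where
  "sat x a b = (\<chi> i. if x $ i < a $ i then a $ i else if x $ i \<le> b $ i then x $ i else b $ i)"

definition compatible_constraints :: "real^'e \<Rightarrow> real^'e::finite \<Rightarrow> bool" where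
  "compatible_constraints um up \<longleftrightarrow>
     (\<forall>i. up $ i \<ge> um $ i \<and> um $ i \<ge> 0 \<and> \<not> (up $ i = um $ i \<and> um $ i = 0))"

text \<open>The order on \<open>real^'e\<close> is componentwise, so \<open>{um..up}\<close> is the box of the constraints.\<close>

definition interior_point_condition ::
    "('e::finite \<Rightarrow> 'v::finite) \<Rightarrow> ('e \<Rightarrow> 'v) \<Rightarrow> real^'e \<Rightarrow> real^'e \<Rightarrow> bool" where
  "interior_point_condition tail head um up \<longleftrightarrow>
     (\<exists>z\<in>{um..up}.
        incidence_matrix tail head *v sat z um up = incidence_matrix tail head *v z \<and>
        incidence_matrix tail head *v z = 0 \<and>
        (\<exists>T \<subseteq> {i. z $ i \<in> interior {um $ i..up $ i}}. spanning_tree tail head T))"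

definition partial_deriv :: "'v::finite \<Rightarrow> (real^'v \<Rightarrow> real) \<Rightarrow> real^'v \<Rightarrow> real" where
  "partial_deriv i f x = deriv (\<lambda>s. f (x + s *\<^sub>R axis i 1)) 0"

definition gradient :: "(real^'v::finite \<Rightarrow> real) \<Rightarrow> real^'v \<Rightarrow> real^'v" where
  "gradient f x = (\<chi> i. partial_deriv i f x)"

definition hessian :: "(real^'v::finite \<Rightarrow> real) \<Rightarrow> real^'v \<Rightarrow> real^'v^'v" where
  "hessian f x = (\<chi> i j. partial_deriv i (partial_deriv j f) x)"

definition twice_differentiable :: "(real^'v::finite \<Rightarrow> real) \<Rightarrow> bool" where
  "twice_differentiable f \<longleftrightarrow>
     (\<forall>x. f differentiable (at x)) \<and> (\<forall>x. gradient f differentiable (at x))"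

text \<open>
  Symmetry is not part of the definition: the Hessian of a twice differentiable function is
  always symmetric.
\<close>

definition positive_definite :: "real^'v^'v::finite \<Rightarrow> bool" where
  "positive_definite A \<longleftrightarrow> (\<forall>v. v \<noteq> 0 \<longrightarrow> v \<bullet> (A *v v) > 0)"

definition strictly_convex :: "('a::real_vector \<Rightarrow> real) \<Rightarrow> bool" where
  "strictly_convex f \<longleftrightarrow>
     (\<forall>x y t. x \<noteq> y \<and> 0 < t \<and> t < 1 \<longrightarrow>
        f ((1 - t) *\<^sub>R x + t *\<^sub>R y) < (1 - t) * f x + t * f y)"

definition admissible_set :: "real^'v::finite \<Rightarrow> (real^'v) set" where
  "admissible_set x0 = {x. 1 \<bullet> x = 1 \<bullet> x0}"

text \<open>
  Trajectories are differentiable solutions on \<open>[0, \<infinity>)\<close>. The right-hand side is continuous and the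
  flow through the edges is bounded, so no solution blows up in finite time.
\<close>

definition closed_loop_trajectory ::
    "('e::finite \<Rightarrow> 'v::finite) \<Rightarrow> ('e \<Rightarrow> 'v) \<Rightarrow> (real^'v \<Rightarrow> real) \<Rightarrow> real^'e \<Rightarrow> real^'e \<Rightarrow>
     (real \<Rightarrow> real^'v) \<Rightarrow> (real \<Rightarrow> real^'e) \<Rightarrow> bool" where
  "closed_loop_trajectory tail head H um up xt xc \<longleftrightarrow>
     (let B = incidence_matrix tail head in
      \<forall>t\<ge>0.
        (xt has_vector_derivative
           B *v sat (- (transpose B *v gradient H (xt t)) - xc t) um up) (at t within {0..}) \<and>
        (xc has_vector_derivative transpose B *v gradient H (xt t)) (at t within {0..}))"

definition E_tot ::
    "('e::finite \<Rightarrow> 'v::finite) \<Rightarrow> ('e \<Rightarrow> 'v) \<Rightarrow> real^'e \<Rightarrow> real^'e \<Rightarrow> ((real^'v) \<times> (real^'e)) set" where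
  "E_tot tail head um up = {(0, xc) | xc. incidence_matrix tail head *v sat (- xc) um up = 0}"

text \<open>
  The distance to the empty set is \<open>\<infinity>\<close>, whereas \<open>infdist\<close> is \<open>0\<close> there; hence the first conjunct.
  It matters, since \<open>E_tot\<close> is empty when the constraints admit no circulation.
\<close>

definition converges_into :: "(real \<Rightarrow> 'a::metric_space) \<Rightarrow> 'a set \<Rightarrow> bool" where
  "converges_into \<phi> S \<longleftrightarrow> S \<noteq> {} \<and> ((\<lambda>t. infdist (\<phi> t) S) \<longlongrightarrow> 0) at_top"

end

theory Submission
  imports Defs
begin

text \<open>
  Write \<open>q\<close> for the shifted state, \<open>c\<close> for the controller state, \<open>d = B\<^sup>T \<nabla>H(q)\<close> for the tension and
  \<open>g\<close> for the saturation, so that \<open>q' = B g(-d - c)\<close> and \<open>c' = d\<close>.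

  \<^bold>\<open>Sufficiency.\<close> Let \<open>z\<close> be a circulation with interior values on a spanning tree and \<open>\<Phi>\<^sub>i\<close> a
  primitive of the \<open>i\<close>-th scalar saturation. Along trajectories
  \<open>H(q) + \<Sum>\<^sub>i (\<Phi>\<^sub>i(-c\<^sub>i) + z\<^sub>i c\<^sub>i)\<close> has derivative \<open>-\<Sum>\<^sub>i d\<^sub>i (g\<^sub>i(-c\<^sub>i) - g\<^sub>i(-c\<^sub>i - d\<^sub>i))\<close>, which is not
  positive because \<open>g\<^sub>i\<close> is monotone. The function bounds \<open>q\<close>, since \<open>H\<close> is coercive, and \<open>c\<^sub>i\<close> on the
  tree, since \<open>z\<^sub>i\<close> is interior there; a path in the tree expresses every other \<open>c\<^sub>e\<close> through tree
  edges up to a constant. The usual end of the argument is LaSalle's invariance principle. Here the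
  gradient of \<open>H\<close> need not be locally Lipschitz, so solutions need not be unique, and a direct
  argument replaces it. By Barbalat's lemma every term of the dissipation tends to \<open>0\<close>. Hence
  \<open>g(-d - c) - g(-c)\<close> tends to \<open>0\<close>, and \<open>g(-c)\<close> varies more and more slowly
  (\<open>g_integrator_slowly_varying\<close>). A bounded curve whose velocity varies slowly has velocity tending
  to \<open>0\<close> (\<open>bounded_slowly_varying_derivative_tendsto_zero\<close>). Applied to \<open>q\<close> this gives
  \<open>B g(-d - c) \<longlongrightarrow> 0\<close>; then \<open>q\<close>, and with it \<open>d\<close>, varies slowly, and the same fact
  applied to \<open>c\<close> gives \<open>d \<longlongrightarrow> 0\<close>. On states of total mass \<open>0\<close> a vanishing tension forces \<open>q = 0\<close>,
  and compactness turns these limits into convergence of the distance.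

  \<^bold>\<open>Necessity.\<close> If the box contains no circulation, then \<open>E_tot\<close> is empty and any trajectory refutes
  convergence. One exists by Peano's theorem (\<open>peano_global\<close>), which is proved with a cluster point of
  Euler polygons. Otherwise take a circulation \<open>z\<close> with the largest set of interior edges. If these
  edges do not connect the graph, then the residual graph of \<open>z\<close> is not strongly connected: pushing
  flow along a residual cycle would make further edges interior. So there is a vertex set \<open>U\<close> that no
  residual arc leaves. The minimizer \<open>x\<close> of \<open>H\<close> subject to mass \<open>1\<close> on \<open>U\<close> and \<open>-1\<close> on its
  complement has a gradient with one value on \<open>U\<close> and a smaller one on the complement. With
  \<open>q = x\<close> constant, the tension drives \<open>c\<close> along edges across the cut only, and there deeper into
  saturation. So the flow stays \<open>z\<close> and \<open>q = x \<noteq> 0\<close> forever (\<open>drifting_trajectory\<close>).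
\<close>

section \<open>Scalar saturation and two of its primitives\<close>

definition clip :: "real \<Rightarrow> real \<Rightarrow> real \<Rightarrow> real" where
  "clip a b s = max a (min s b)"

lemma clip_in: "a \<le> b \<Longrightarrow> clip a b s \<in> {a..b}"
  by (auto simp: clip_def)

lemma clip_mono: "s \<le> r \<Longrightarrow> clip a b s \<le> clip a b r"
  by (auto simp: clip_def)

lemma clip_lipschitz: "\<bar>clip a b r - clip a b s\<bar> \<le> \<bar>r - s\<bar>"
  by (auto simp: clip_def max_def min_def)

text \<open>
  Co-coercivity: monotonicity gives the product a sign, and the Lipschitz constant \<open>1\<close> lets one factor
  be replaced by the smaller increment of \<open>clip\<close>.
\<close>

lemma clip_diff_mult: "(clip a b r - clip a b s)\<^sup>2 \<le> (r - s) * (clip a b r - clip a b s)"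
proof -
  have *: "(clip a b r - clip a b s)\<^sup>2 \<le> (r - s) * (clip a b r - clip a b s)" if "s \<le> r" for r s
    using clip_mono[OF that, of a b] clip_lipschitz[of a b r s] that
    by (auto simp: power2_eq_square intro: mult_right_mono)
  show ?thesis
    using *[of s r] *[of r s] by (cases "s \<le> r") (auto simp: power2_eq_square algebra_simps)
qed

lemma clip_continuous: "continuous_on S (clip a b)"
  unfolding clip_def by (intro continuous_intros)

lemma has_real_derivative_quadratic_bound:
  fixes F :: "real \<Rightarrow> real"
  assumes "\<And>r. \<bar>F r - F s - k * (r - s)\<bar> \<le> C * (r - s)\<^sup>2"
  shows "(F has_real_derivative k) (at s)"
proof -
  have "((\<lambda>r. (F r - F s) / (r - s) - k) \<longlongrightarrow> 0) (at s)"
  proof (rule Lim_null_comparison)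
    show "eventually (\<lambda>r. norm ((F r - F s) / (r - s) - k) \<le> C * \<bar>r - s\<bar>) (at s)"
    proof (rule eventually_at_filter[THEN iffD2], rule always_eventually, safe)
      fix r assume "r \<noteq> s"
      then have "(F r - F s) / (r - s) - k = (F r - F s - k * (r - s)) / (r - s)"
        by (simp add: field_simps)
      then have "norm ((F r - F s) / (r - s) - k) = \<bar>F r - F s - k * (r - s)\<bar> / \<bar>r - s\<bar>"
        by simp
      also have "\<dots> \<le> C * (r - s)\<^sup>2 / \<bar>r - s\<bar>"
        by (intro divide_right_mono assms) auto
      also have "\<dots> = C * \<bar>r - s\<bar>"
        using \<open>r \<noteq> s\<close> by (simp add: field_simps power2_eq_square)
      finally show "norm ((F r - F s) / (r - s) - k) \<le> C * \<bar>r - s\<bar>" .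
    qed
    show "((\<lambda>r. C * \<bar>r - s\<bar>) \<longlongrightarrow> 0) (at s)"
      by (auto intro!: tendsto_eq_intros)
  qed
  then show ?thesis
    unfolding has_field_derivative_iff using Lim_null by blast
qed

text \<open>
  This equals \<open>max {s c - c\<^sup>2 / 2 | c \<in> {a..b}}\<close>, the Legendre transform of \<open>c\<^sup>2 / 2\<close> restricted to
  the interval.
\<close>

definition clip_primitive :: "real \<Rightarrow> real \<Rightarrow> real \<Rightarrow> real" where
  "clip_primitive a b s = s * clip a b s - (clip a b s)\<^sup>2 / 2"

text \<open>
  The maximum in the Legendre transform is attained at \<open>clip a b s\<close>. This one inequality yields the
  derivative of the primitive and its growth at infinity.
\<close>

lemma clip_primitive_ge:
  assumes "c \<in> {a..b}"
  shows "s * c - c\<^sup>2 / 2 \<le> clip_primitive a b s"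
proof -
  define k where "k = clip a b s"
  have "0 \<le> (s - k) * (k - c)"
    using assms unfolding k_def clip_def
    by (auto simp: max_def min_def mult_nonneg_nonneg mult_nonpos_nonpos)
  moreover have "0 \<le> (k - c)\<^sup>2" by simp
  ultimately show ?thesis
    unfolding clip_primitive_def k_def[symmetric] by (simp add: algebra_simps power2_eq_square)
qed

text \<open>
  The increment from \<open>s\<close> to \<open>r\<close> lies between \<open>(r - s) clip s\<close> and \<open>(r - s) clip r\<close>, as for any convex
  function, and these two differ by at most \<open>(r - s)\<^sup>2\<close>.
\<close>

lemma clip_primitive_derivative:
  assumes "a \<le> b"
  shows "(clip_primitive a b has_real_derivative clip a b s) (at s)"
proof (rule has_real_derivative_quadratic_bound[where C = 1])
  fix r
  have lower: "clip a b u * (v - u) \<le> clip_primitive a b v - clip_primitive a b u" for u v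
    using clip_primitive_ge[OF clip_in[OF assms, of u], of v]
    by (simp add: clip_primitive_def algebra_simps)
  have "(clip a b r - clip a b s) * (r - s) \<le> \<bar>clip a b r - clip a b s\<bar> * \<bar>r - s\<bar>"
    by (simp add: abs_mult[symmetric])
  also have "\<dots> \<le> \<bar>r - s\<bar> * \<bar>r - s\<bar>"
    by (intro mult_right_mono clip_lipschitz) auto
  finally have "(clip a b r - clip a b s) * (r - s) \<le> (r - s)\<^sup>2"
    by (simp add: power2_eq_square)
  then show "\<bar>clip_primitive a b r - clip_primitive a b s - clip a b s * (r - s)\<bar> \<le> 1 * (r - s)\<^sup>2"
    using lower[of s r] lower[of r s] by (simp add: algebra_simps abs_le_iff)
qed

text \<open>
  The primitive of \<open>(x - a) (b - x)\<close>, evaluated at \<open>clip a b s\<close>. As this weight vanishes at both ends of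
  the interval, the composition is differentiable even at the corners of \<open>clip\<close>.
\<close>

definition clip_cubic :: "real \<Rightarrow> real \<Rightarrow> real \<Rightarrow> real" where
  "clip_cubic a b s = (b - a) * (clip a b s - a)\<^sup>2 / 2 - (clip a b s - a) ^ 3 / 3"

lemma clip_cubic_derivative:
  assumes "a \<le> b"
  shows "(clip_cubic a b has_real_derivative (clip a b s - a) * (b - clip a b s)) (at s)"
proof -
  let ?P = "\<lambda>x. (b - a) * (x - a)\<^sup>2 / 2 - (x - a) ^ 3 / 3"
  consider "s = a \<or> s = b" | "a < s" "s < b" | "s < a" | "b < s" by linarith
  then show ?thesis
  proof cases
    case 1
    then have zero: "(clip a b s - a) * (b - clip a b s) = 0" using assms by (auto simp: clip_def)
    have "\<bar>clip_cubic a b r - clip_cubic a b s - 0 * (r - s)\<bar> \<le> (b - a) * (r - s)\<^sup>2" for r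
    proof -
      define y where "y = clip a b r"
      have y: "a \<le> y" "y \<le> b" using clip_in[OF assms, of r] by (auto simp: y_def)
      have cs: "clip a b s = s" using 1 assms by (auto simp: clip_def)
      have ys: "(y - s)\<^sup>2 \<le> (r - s)\<^sup>2"
        using clip_lipschitz[of a b r s] cs by (metis y_def abs_le_square_iff)
      have "\<bar>?P y - ?P s\<bar> \<le> (b - a) * (y - s)\<^sup>2"
      proof -
        define u where "u = \<bar>y - s\<bar>"
        have u: "0 \<le> u" "u \<le> b - a" using y 1 by (auto simp: u_def)
        have cases: "?P y - ?P s = (b - a) * u\<^sup>2 / 2 - u ^ 3 / 3 \<or> ?P y - ?P s = - ((b - a) * u\<^sup>2 / 2 - u ^ 3 / 3)"
          using 1
        proof
          assume "s = a"
          then show ?thesis using y by (auto simp: u_def)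
        next
          assume "s = b"
          then have "y = b - u" using y by (auto simp: u_def)
          have "?P (b - u) - ?P b = - ((b - a) * u\<^sup>2 / 2 - u ^ 3 / 3)"
            by (simp add: power2_eq_square power3_eq_cube field_simps)
          then show ?thesis using \<open>s = b\<close> \<open>y = b - u\<close> by simp
        qed
        have "0 \<le> u ^ 3" "u ^ 3 \<le> (b - a) * u\<^sup>2" "0 \<le> (b - a) * u\<^sup>2"
          using u mult_right_mono[OF u(2), of "u * u"] by (auto simp: power3_eq_cube power2_eq_square mult.assoc)
        moreover have "\<bar>A\<bar> \<le> X" if "A = X / 2 - q / 3 \<or> A = - (X / 2 - q / 3)" "0 \<le> q" "q \<le> X" for A X q :: real
          using that by auto
        ultimately have "\<bar>?P y - ?P s\<bar> \<le> (b - a) * u\<^sup>2" using cases by blast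
        then show ?thesis by (simp add: u_def)

      qed
      also have "\<dots> \<le> (b - a) * (r - s)\<^sup>2" using ys assms by (intro mult_left_mono) auto
      finally show ?thesis by (simp add: clip_cubic_def y_def[symmetric] cs)
    qed
    then show ?thesis unfolding zero by (rule has_real_derivative_quadratic_bound)
  next
    case 2
    have "(?P has_real_derivative (s - a) * (b - s)) (at s)"
      by (auto intro!: derivative_eq_intros simp: power2_eq_square field_simps)
    moreover have "eventually (\<lambda>x. x \<in> {a<..<b}) (nhds s)"
      using 2 by (intro eventually_nhds_in_open) auto
    then have "eventually (\<lambda>x. clip_cubic a b x = ?P x) (nhds s)"
      by eventually_elim (auto simp: clip_cubic_def clip_def)
    moreover have "clip a b s = s" using 2 by (auto simp: clip_def)
    ultimately show ?thesis by (simp add: DERIV_cong_ev)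
  next
    case 3
    have "eventually (\<lambda>x. x \<in> {..<a}) (nhds s)"
      using 3 by (intro eventually_nhds_in_open) auto
    then have "eventually (\<lambda>x. clip_cubic a b x = 0) (nhds s)"
      by eventually_elim (use assms in \<open>auto simp: clip_cubic_def clip_def\<close>)
    moreover have "clip a b s = a" using 3 assms by (auto simp: clip_def)
    ultimately show ?thesis by (simp add: DERIV_cong_ev)
  next
    case 4
    have "eventually (\<lambda>x. x \<in> {b<..}) (nhds s)"
      using 4 by (intro eventually_nhds_in_open) auto
    then have "eventually (\<lambda>x. clip_cubic a b x = ?P b) (nhds s)"
      by eventually_elim (use assms in \<open>auto simp: clip_cubic_def clip_def\<close>)
    moreover have "clip a b s = b" using 4 assms by (auto simp: clip_def)
    ultimately show ?thesis by (simp add: DERIV_cong_ev)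
  qed
qed

text \<open>
  Small changes of \<open>clip_cubic\<close> force small changes of \<open>clip\<close>, because for \<open>x \<le> y\<close> in the interval
  the integral of \<open>(t - a) (b - t)\<close> over \<open>{x..y}\<close> is at least that of \<open>(t - x) (y - t)\<close>, which is
  \<open>(y - x)\<^sup>3 / 6\<close>.
\<close>

lemma clip_cubic_separates:
  assumes "a \<le> b"
  shows "\<bar>clip a b r - clip a b s\<bar> ^ 3 \<le> 6 * \<bar>clip_cubic a b r - clip_cubic a b s\<bar>"
proof -
  have *: "(clip a b r - clip a b s) ^ 3 \<le> 6 * (clip_cubic a b r - clip_cubic a b s)" if "s \<le> r" for r s
  proof -
    define u d k where "u = clip a b s - a" and "d = clip a b r - clip a b s" and "k = b - clip a b r"
    have nn: "0 \<le> u" "0 \<le> d" "0 \<le> k"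
      using clip_in[OF assms] clip_mono[OF that, of a b] by (auto simp: u_def d_def k_def)
    have eq: "clip a b s - a = u" "clip a b r - a = u + d" "clip a b r - clip a b s = d" "b - a = u + d + k"
      by (auto simp: u_def d_def k_def)
    have "6 * (clip_cubic a b r - clip_cubic a b s) - d ^ 3 = 3 * u * d\<^sup>2 + 6 * k * (u * d + d\<^sup>2 / 2)"
      unfolding clip_cubic_def eq by (simp add: power2_eq_square power3_eq_cube field_simps)
    also have "\<dots> \<ge> 0" using nn by auto
    finally show ?thesis unfolding eq by simp
  qed
  have **: "\<bar>clip a b r - clip a b s\<bar> ^ 3 \<le> 6 * \<bar>clip_cubic a b r - clip_cubic a b s\<bar>" if "s \<le> r" for r s
    using *[OF that] clip_mono[OF that, of a b] by (simp add: abs_if)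
  show ?thesis using **[of s r] **[of r s] by (cases "s \<le> r") (auto simp: abs_minus_commute)
qed

text \<open>
  If \<open>s\<close> moves with speed \<open>d\<close>, the left-hand side is the absolute speed of \<open>clip_cubic\<close>, and \<open>w\<close> is the dissipation
  of one edge. For \<open>s\<close> inside the interval, \<open>w\<close> is \<open>\<bar>d\<bar>\<close> times the smaller of \<open>\<bar>d\<bar>\<close> and the distance
  from \<open>s\<close> to the end that \<open>s - d\<close> approaches; so either \<open>d\<close> is small or the weight is.
\<close>

lemma clip_cubic_rate_bound:
  fixes a b s d :: real
  assumes "a \<le> b"
  defines "w \<equiv> d * (clip a b s - clip a b (s - d))"
  shows "\<bar>(clip a b s - a) * (b - clip a b s) * d\<bar> \<le> (b - a)\<^sup>2 * sqrt w + (b - a) * w"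
proof -
  have "(clip a b s - clip a b (s - d))\<^sup>2 \<le> w"
    using clip_diff_mult[of a b s "s - d"] by (simp add: w_def)
  then have w0: "0 \<le> w" by (rule order_trans[OF zero_le_power2])
  show ?thesis
  proof (cases "a < s \<and> s < b")
    case False
    then have "clip a b s = a \<or> clip a b s = b" using assms(1) by (auto simp: clip_def)
    then show ?thesis using w0 assms(1) by auto
  next
    case True
    then have cs: "clip a b s = s" by (auto simp: clip_def)
    \<comment> \<open>\<open>x\<close> is the distance from \<open>s\<close> to the end on the side of \<open>s - d\<close>, \<open>y\<close> the distance to the other end.\<close>
    have key: "x * y * \<bar>d\<bar> \<le> (b - a)\<^sup>2 * sqrt w + (b - a) * w"
      if "w = \<bar>d\<bar> * min \<bar>d\<bar> x" "0 \<le> x" "0 \<le> y" "x + y = b - a" for x y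
    proof (cases "\<bar>d\<bar> \<le> x")
      case True
      then have "w = d\<^sup>2" using that by (simp add: power2_eq_square)
      then have "\<bar>d\<bar> = sqrt w" by simp
      have "x * y \<le> (b - a) * (b - a)" using that by (intro mult_mono) auto
      then have "x * y * \<bar>d\<bar> \<le> (b - a)\<^sup>2 * sqrt w"
        unfolding \<open>\<bar>d\<bar> = sqrt w\<close> power2_eq_square using w0 by (intro mult_right_mono) auto
      then show ?thesis using w0 assms(1) by (simp add: add_increasing2)
    next
      case False
      then have "x * y * \<bar>d\<bar> = y * w" using that by simp
      also have "\<dots> \<le> (b - a) * w" using that w0 by (intro mult_right_mono) auto
      finally show ?thesis using w0 by (simp add: add_increasing)
    qed
    show ?thesis
    proof (cases "d \<ge> 0")
      case True
      then have "s - clip a b (s - d) = min d (s - a)"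
        using \<open>a < s \<and> s < b\<close> by (auto simp: clip_def)
      then show ?thesis
        using key[of "s - a" "b - s"] True \<open>a < s \<and> s < b\<close> by (simp add: w_def cs abs_mult)
    next
      case False
      then have "s - clip a b (s - d) = - min (- d) (b - s)"
        using \<open>a < s \<and> s < b\<close> by (auto simp: clip_def)
      then show ?thesis
        using key[of "b - s" "s - a"] False \<open>a < s \<and> s < b\<close> by (simp add: w_def cs abs_mult mult.commute)
    qed
  qed
qed

section \<open>Asymptotics of slowly varying curves\<close>

text \<open>
  The increment of \<open>v\<close> over any time window of fixed length tends to \<open>0\<close>. Boundedness or convergence
  of \<open>v\<close> is not implied: \<open>ln\<close> is an example.
\<close>

definition slowly_varying :: "(real \<Rightarrow> 'a::metric_space) \<Rightarrow> bool" where
  "slowly_varying v \<longleftrightarrow>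
     (\<forall>N. \<forall>\<epsilon>>0. eventually (\<lambda>t. \<forall>s\<in>{0..N}. dist (v (t + s)) (v t) < \<epsilon>) at_top)"

lemma eventually_at_top_forward:
  fixes P :: "real \<Rightarrow> bool"
  assumes "eventually P at_top"
  shows "eventually (\<lambda>t. \<forall>s\<ge>0. P (t + s)) at_top"
proof -
  obtain T where "\<And>t. t \<ge> T \<Longrightarrow> P t" using assms by (auto simp: eventually_at_top_linorder)
  then show ?thesis by (intro eventually_at_top_linorderI[of T]) auto
qed

lemma slowly_varying_tendsto_zero_diff:
  fixes u v :: "real \<Rightarrow> 'a::real_normed_vector"
  assumes "slowly_varying u" and "((\<lambda>t. v t - u t) \<longlongrightarrow> 0) at_top"
  shows "slowly_varying v"
  unfolding slowly_varying_def
proof (intro allI impI)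
  fix N \<epsilon> :: real assume "\<epsilon> > 0"
  then have "eventually (\<lambda>t. \<forall>s\<in>{0..N}. dist (u (t + s)) (u t) < \<epsilon> / 3) at_top"
    using assms(1)[unfolded slowly_varying_def, rule_format, of "\<epsilon> / 3" N] by simp
  moreover have "eventually (\<lambda>t. \<forall>s\<ge>0. norm (v (t + s) - u (t + s)) < \<epsilon> / 3) at_top"
    using tendstoD[OF assms(2), of "\<epsilon> / 3"] \<open>\<epsilon> > 0\<close>
    by (intro eventually_at_top_forward) (auto simp: dist_norm)
  ultimately show "eventually (\<lambda>t. \<forall>s\<in>{0..N}. dist (v (t + s)) (v t) < \<epsilon>) at_top"
  proof eventually_elim
    case (elim t)
    show ?case
    proof
      fix s assume s: "s \<in> {0..N}"
      have "v (t + s) - v t = (v (t + s) - u (t + s)) + (u (t + s) - u t) - (v t - u t)" by simp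
      then have "norm (v (t + s) - v t) \<le> norm ((v (t + s) - u (t + s)) + (u (t + s) - u t)) + norm (v t - u t)"
        by (metis norm_triangle_ineq4)
      also have "\<dots> \<le> norm (v (t + s) - u (t + s)) + norm (u (t + s) - u t) + norm (v t - u t)"
        by (intro add_right_mono norm_triangle_ineq)
      finally have "norm (v (t + s) - v t)
          \<le> norm (v (t + s) - u (t + s)) + norm (u (t + s) - u t) + norm (v t - u t)" .
      moreover have "norm (v t - u t) < \<epsilon> / 3" using elim(2)[rule_format, of 0] by simp
      ultimately show "dist (v (t + s)) (v t) < \<epsilon>"
        using elim(1)[rule_format, OF s] elim(2)[rule_format, of s] s by (simp add: dist_norm)
    qed
  qed
qed

lemma slowly_varying_compose:
  assumes "slowly_varying v" and "uniformly_continuous_on K F" and "eventually (\<lambda>t. v t \<in> K) at_top"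
  shows "slowly_varying (\<lambda>t. F (v t))"
  unfolding slowly_varying_def
proof (intro allI impI)
  fix N \<epsilon> :: real assume "\<epsilon> > 0"
  then obtain \<delta> where \<delta>: "\<delta> > 0" "\<And>x y. x \<in> K \<Longrightarrow> y \<in> K \<Longrightarrow> dist x y < \<delta> \<Longrightarrow> dist (F x) (F y) < \<epsilon>"
    using assms(2) unfolding uniformly_continuous_on_def by metis
  then have "eventually (\<lambda>t. \<forall>s\<in>{0..N}. dist (v (t + s)) (v t) < \<delta>) at_top"
    using assms(1) by (auto simp: slowly_varying_def)
  with eventually_at_top_forward[OF assms(3)]
  show "eventually (\<lambda>t. \<forall>s\<in>{0..N}. dist (F (v (t + s))) (F (v t)) < \<epsilon>) at_top"
  proof eventually_elim
    case (elim t)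
    show ?case
    proof
      fix s assume s: "s \<in> {0..N}"
      have "v (t + s) \<in> K" "v t \<in> K" using elim(1)[rule_format, of s] elim(1)[rule_format, of 0] s by auto
      then show "dist (F (v (t + s))) (F (v t)) < \<epsilon>" using \<delta>(2) elim(2) s by blast
    qed
  qed
qed

lemma slowly_varying_vec:
  fixes v :: "real \<Rightarrow> real^'n::finite"
  assumes "\<And>i. slowly_varying (\<lambda>t. v t $ i)"
  shows "slowly_varying v"
  unfolding slowly_varying_def
proof (intro allI impI)
  fix N \<epsilon> :: real assume "\<epsilon> > 0"
  have "eventually (\<lambda>t. \<forall>i. \<forall>s\<in>{0..N}. dist (v (t + s) $ i) (v t $ i) < \<epsilon> / CARD('n)) at_top"
    using assms \<open>\<epsilon> > 0\<close> unfolding slowly_varying_def by (intro eventually_all_finite) auto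
  then show "eventually (\<lambda>t. \<forall>s\<in>{0..N}. dist (v (t + s)) (v t) < \<epsilon>) at_top"
  proof eventually_elim
    case (elim t)
    show ?case
    proof
      fix s assume s: "s \<in> {0..N}"
      have "norm (v (t + s) - v t) \<le> (\<Sum>i\<in>UNIV. \<bar>(v (t + s) - v t) $ i\<bar>)" by (rule norm_le_l1_cart)
      also have "\<dots> < (\<Sum>i\<in>(UNIV::'n set). \<epsilon> / CARD('n))"
        using elim s by (intro sum_strict_mono) (auto simp: dist_norm)
      also have "\<dots> = \<epsilon>" by simp
      finally show "dist (v (t + s)) (v t) < \<epsilon>" by (simp add: dist_norm)
    qed
  qed
qed

lemma tendsto_zero_vec:
  fixes v :: "real \<Rightarrow> real^'n::finite"
  assumes "\<And>i. ((\<lambda>t. v t $ i) \<longlongrightarrow> 0) at_top"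
  shows "(v \<longlongrightarrow> 0) at_top"
  by (rule vec_tendstoI) (use assms in auto)

text \<open>
  The mean value inequality for \<open>X - s w\<close>; with \<open>w = 0\<close> it is a Lipschitz bound.
\<close>

lemma norm_increment_bound:
  fixes X v :: "real \<Rightarrow> 'a::real_normed_vector"
  assumes der: "\<And>t. t \<ge> 0 \<Longrightarrow> (X has_vector_derivative v t) (at t within {0..})"
    and "0 \<le> t" "0 \<le> \<tau>"
    and bound: "\<And>s. s \<in> {0..\<tau>} \<Longrightarrow> norm (v (t + s) - w) \<le> \<epsilon>"
  shows "norm (X (t + \<tau>) - X t - \<tau> *\<^sub>R w) \<le> \<epsilon> * \<tau>"
proof -
  define Y where "Y s = X s - s *\<^sub>R w" for s
  have d: "(Y has_derivative (\<lambda>h. h *\<^sub>R (v s - w))) (at s within {t..t+\<tau>})" if "s \<in> {t..t+\<tau>}" for s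
  proof -
    have "(X has_vector_derivative v s) (at s within {t..t+\<tau>})"
      using that assms(2) by (auto intro!: has_vector_derivative_within_subset[OF der])
    then have "(Y has_vector_derivative (v s - w)) (at s within {t..t+\<tau>})"
      unfolding Y_def by (auto intro!: derivative_eq_intros)
    then show ?thesis by (simp add: has_vector_derivative_def)
  qed
  have "norm (Y (t + \<tau>) - Y t) \<le> \<epsilon> * norm (t + \<tau> - t)"
  proof (rule differentiable_bound[OF convex_real_interval(5) d])
    fix s assume "s \<in> {t..t + \<tau>}"
    then have "norm (v s - w) \<le> \<epsilon>" using bound[of "s - t"] by auto
    then show "onorm (\<lambda>h. h *\<^sub>R (v s - w)) \<le> \<epsilon>"
      by (intro onorm_le) (auto simp: mult.commute[of \<epsilon>] intro: mult_left_mono)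
  qed (use assms in auto)
  then show ?thesis using assms(3) by (simp add: Y_def algebra_simps)
qed

text \<open>
  Over a window of length \<open>\<tau>\<close> on which \<open>v\<close> is nearly constant, \<open>X\<close> moves by nearly \<open>\<tau> v\<close>; if it moves by
  less than \<open>\<epsilon> \<tau>\<close>, then \<open>v\<close> is small. Barbalat's lemma uses short windows and a convergent \<open>X\<close>, the
  lemma on slowly varying velocities uses long windows and a bounded \<open>X\<close>.
\<close>

lemma derivative_tendsto_zero:
  fixes X v :: "real \<Rightarrow> 'a::real_normed_vector"
  assumes der: "\<And>t. t \<ge> 0 \<Longrightarrow> (X has_vector_derivative v t) (at t within {0..})"
    and small: "\<And>\<epsilon>. \<epsilon> > 0 \<Longrightarrow> \<exists>\<tau>>0. eventually (\<lambda>t. norm (X (t + \<tau>) - X t) \<le> \<epsilon> * \<tau> \<and>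
                        (\<forall>s\<in>{0..\<tau>}. dist (v (t + s)) (v t) \<le> \<epsilon>)) at_top"
  shows "(v \<longlongrightarrow> 0) at_top"
proof (rule tendstoI)
  fix e :: real assume "e > 0"
  define \<epsilon> where "\<epsilon> = e / 3"
  have "\<epsilon> > 0" using \<open>e > 0\<close> by (simp add: \<epsilon>_def)
  from small[OF this] obtain \<tau> where "\<tau> > 0"
    and ev: "eventually (\<lambda>t. norm (X (t + \<tau>) - X t) \<le> \<epsilon> * \<tau> \<and>
                        (\<forall>s\<in>{0..\<tau>}. dist (v (t + s)) (v t) \<le> \<epsilon>)) at_top" by auto
  from ev eventually_ge_at_top[of 0] show "eventually (\<lambda>t. dist (v t) 0 < e) at_top"
  proof eventually_elim
    case (elim t)
    have "norm (X (t + \<tau>) - X t - \<tau> *\<^sub>R v t) \<le> \<epsilon> * \<tau>"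
      by (rule norm_increment_bound[OF der]) (use elim \<open>\<tau> > 0\<close> in \<open>auto simp: dist_norm\<close>)
    then have "norm (\<tau> *\<^sub>R v t) \<le> \<epsilon> * \<tau> + \<epsilon> * \<tau>"
      using elim norm_triangle_ineq4[of "X (t + \<tau>) - X t" "X (t + \<tau>) - X t - \<tau> *\<^sub>R v t"] by simp
    then have "\<tau> * norm (v t) \<le> \<tau> * (2 * \<epsilon>)" using \<open>\<tau> > 0\<close> by (simp add: algebra_simps)
    then show ?case using \<open>\<tau> > 0\<close> \<open>e > 0\<close> by (simp add: \<epsilon>_def)
  qed
qed

lemma barbalat:
  fixes X v :: "real \<Rightarrow> 'a::real_normed_vector"
  assumes der: "\<And>t. t \<ge> 0 \<Longrightarrow> (X has_vector_derivative v t) (at t within {0..})"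
    and lim: "(X \<longlongrightarrow> L) at_top"
    and uc: "uniformly_continuous_on {0..} v"
  shows "(v \<longlongrightarrow> 0) at_top"
proof (rule derivative_tendsto_zero[OF der])
  fix \<epsilon> :: real assume "\<epsilon> > 0"
  then obtain \<delta> where \<delta>: "\<delta> > 0" "\<And>x y. x \<ge> 0 \<Longrightarrow> y \<ge> 0 \<Longrightarrow> dist x y < \<delta> \<Longrightarrow> dist (v x) (v y) < \<epsilon>"
    using uc unfolding uniformly_continuous_on_def by (metis atLeast_iff)
  define \<tau> where "\<tau> = \<delta> / 2"
  have "\<tau> > 0" using \<delta>(1) by (simp add: \<tau>_def)
  then have "eventually (\<lambda>t. dist (X t) L < \<epsilon> * \<tau> / 2) at_top"
    using \<open>\<epsilon> > 0\<close> by (intro tendstoD[OF lim]) auto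
  from eventually_at_top_forward[OF this] eventually_ge_at_top[of 0]
  have "eventually (\<lambda>t. norm (X (t + \<tau>) - X t) \<le> \<epsilon> * \<tau> \<and> (\<forall>s\<in>{0..\<tau>}. dist (v (t + s)) (v t) \<le> \<epsilon>)) at_top"
  proof eventually_elim
    case (elim t)
    have "dist (X (t + \<tau>)) L < \<epsilon> * \<tau> / 2" "dist (X t) L < \<epsilon> * \<tau> / 2"
      using elim(1)[rule_format, of \<tau>] elim(1)[rule_format, of 0] \<open>\<tau> > 0\<close> by auto
    then have "dist (X (t + \<tau>)) (X t) \<le> \<epsilon> * \<tau>"
      using dist_triangle2[of "X (t + \<tau>)" "X t" L] by linarith
    moreover have "dist (v (t + s)) (v t) \<le> \<epsilon>" if "s \<in> {0..\<tau>}" for s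
      using \<delta>(2)[of "t + s" t] that elim \<delta>(1) by (auto simp: \<tau>_def dist_norm)
    ultimately show ?case by (auto simp: dist_norm)
  qed
  then show "\<exists>\<tau>>0. eventually (\<lambda>t. norm (X (t + \<tau>) - X t) \<le> \<epsilon> * \<tau> \<and>
      (\<forall>s\<in>{0..\<tau>}. dist (v (t + s)) (v t) \<le> \<epsilon>)) at_top"
    using \<open>\<tau> > 0\<close> by blast
qed

text \<open>
  A velocity that stays nearly constant over a window of length \<open>\<tau>\<close> would carry \<open>X\<close> over a distance of
  about \<open>\<tau> \<parallel>v\<parallel>\<close>, which a bounded curve cannot afford once \<open>\<tau>\<close> is large.
\<close>

lemma bounded_slowly_varying_derivative_tendsto_zero:
  fixes X v :: "real \<Rightarrow> 'a::real_normed_vector"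
  assumes der: "\<And>t. t \<ge> 0 \<Longrightarrow> (X has_vector_derivative v t) (at t within {0..})"
    and bnd: "\<And>t. t \<ge> 0 \<Longrightarrow> norm (X t) \<le> R"
    and slow: "slowly_varying v"
  shows "(v \<longlongrightarrow> 0) at_top"
proof (rule derivative_tendsto_zero[OF der])
  fix \<epsilon> :: real assume "\<epsilon> > 0"
  have "R \<ge> 0" using order_trans[OF norm_ge_zero bnd[of 0]] by simp
  define \<tau> where "\<tau> = (2 * R + 1) / \<epsilon>"
  have \<tau>: "\<tau> > 0" "\<epsilon> * \<tau> = 2 * R + 1" using \<open>\<epsilon> > 0\<close> \<open>R \<ge> 0\<close> by (auto simp: \<tau>_def)
  have "eventually (\<lambda>t. \<forall>s\<in>{0..\<tau>}. dist (v (t + s)) (v t) < \<epsilon>) at_top"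
    using slow \<open>\<epsilon> > 0\<close> by (auto simp: slowly_varying_def)
  with eventually_ge_at_top[of 0]
  have "eventually (\<lambda>t. norm (X (t + \<tau>) - X t) \<le> \<epsilon> * \<tau> \<and> (\<forall>s\<in>{0..\<tau>}. dist (v (t + s)) (v t) \<le> \<epsilon>)) at_top"
  proof eventually_elim
    case (elim t)
    have "norm (X (t + \<tau>) - X t) \<le> R + R"
      using norm_triangle_ineq4[of "X (t + \<tau>)" "X t"] bnd[of "t + \<tau>"] bnd[of t] elim \<tau> by linarith
    with elim \<tau> show ?case by (auto intro: less_imp_le)
  qed
  then show "\<exists>\<tau>>0. eventually (\<lambda>t. norm (X (t + \<tau>) - X t) \<le> \<epsilon> * \<tau> \<and>
      (\<forall>s\<in>{0..\<tau>}. dist (v (t + s)) (v t) \<le> \<epsilon>)) at_top"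
    using \<tau> by blast
qed

lemma slowly_varying_of_derivative_tendsto_zero:
  fixes X v :: "real \<Rightarrow> 'a::real_normed_vector"
  assumes der: "\<And>t. t \<ge> 0 \<Longrightarrow> (X has_vector_derivative v t) (at t within {0..})"
    and lim: "(v \<longlongrightarrow> 0) at_top"
  shows "slowly_varying X"
  unfolding slowly_varying_def
proof (intro allI impI)
  fix N \<epsilon> :: real assume "\<epsilon> > 0"
  define M where "M = max N 0 + 1"
  have "M > 0" "N < M" by (auto simp: M_def)
  have "eventually (\<lambda>t. dist (v t) 0 < \<epsilon> / M) at_top"
    using \<open>\<epsilon> > 0\<close> \<open>M > 0\<close> by (intro tendstoD[OF lim]) auto
  from eventually_at_top_forward[OF this] eventually_ge_at_top[of 0]
  show "eventually (\<lambda>t. \<forall>s\<in>{0..N}. dist (X (t + s)) (X t) < \<epsilon>) at_top"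
  proof eventually_elim
    case (elim t)
    show ?case
    proof
      fix s assume s: "s \<in> {0..N}"
      have "norm (X (t + s) - X t - s *\<^sub>R 0) \<le> \<epsilon> / M * s"
        by (rule norm_increment_bound[OF der]) (use elim s in \<open>auto simp: less_imp_le\<close>)
      also have "\<dots> < \<epsilon> / M * M"
        using s \<open>N < M\<close> \<open>M > 0\<close> \<open>\<epsilon> > 0\<close> by (intro mult_strict_left_mono) auto
      finally show "dist (X (t + s)) (X t) < \<epsilon>" using \<open>M > 0\<close> by (simp add: dist_norm)
    qed
  qed
qed

text \<open>
  On the points of \<open>K\<close> at distance at least \<open>\<epsilon>\<close> from the zeros, \<open>\<parallel>F\<parallel>\<close> has a positive minimum, or there
  are no such points. In particular \<open>F\<close> has a zero in \<open>K\<close>.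
\<close>

lemma compact_zero_set_attracts:
  fixes F :: "'a::metric_space \<Rightarrow> 'b::real_normed_vector"
  assumes "compact K" and cont: "continuous_on K F"
    and inK: "eventually (\<lambda>t. \<gamma> t \<in> K) at_top"
    and lim: "((\<lambda>t. F (\<gamma> t)) \<longlongrightarrow> 0) (at_top :: real filter)"
    and "\<epsilon> > 0"
  shows "eventually (\<lambda>t. \<exists>z\<in>K. F z = 0 \<and> dist (\<gamma> t) z < \<epsilon>) at_top"
proof -
  define K' where "K' = K - (\<Union>z\<in>{z\<in>K. F z = 0}. ball z \<epsilon>)"
  have "compact K'" unfolding K'_def by (intro compact_diff \<open>compact K\<close>) auto
  show ?thesis
  proof (cases "K' = {}")
    case True
    have "\<exists>z\<in>K. F z = 0 \<and> dist y z < \<epsilon>" if "y \<in> K" for y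
    proof -
      have "y \<in> (\<Union>z\<in>{z\<in>K. F z = 0}. ball z \<epsilon>)" using True that unfolding K'_def by blast
      then show ?thesis by (auto simp: dist_commute)
    qed
    then show ?thesis using inK by (auto elim: eventually_mono)
  next
    case False
    have "continuous_on K' (\<lambda>z. norm (F z))"
      by (intro continuous_on_norm continuous_on_subset[OF cont]) (auto simp: K'_def)
    from continuous_attains_inf[OF \<open>compact K'\<close> False this]
    obtain m where m: "m \<in> K'" "\<And>z. z \<in> K' \<Longrightarrow> norm (F m) \<le> norm (F z)" by auto
    have "F m \<noteq> 0" using m(1) \<open>\<epsilon> > 0\<close> by (force simp: K'_def)
    then have "eventually (\<lambda>t. dist (F (\<gamma> t)) 0 < norm (F m)) at_top" by (intro tendstoD[OF lim]) auto
    with inK show ?thesis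
    proof eventually_elim
      case (elim t)
      then have "\<gamma> t \<notin> K'" using m(2)[of "\<gamma> t"] by auto
      then show ?case using elim by (auto simp: K'_def dist_commute)
    qed
  qed
qed

lemma antimono_bounded_below_converges:
  fixes \<phi> :: "real \<Rightarrow> real"
  assumes mono: "\<And>s t. 0 \<le> s \<Longrightarrow> s \<le> t \<Longrightarrow> \<phi> t \<le> \<phi> s" and lower: "\<And>t. 0 \<le> t \<Longrightarrow> m \<le> \<phi> t"
  shows "\<exists>L. (\<phi> \<longlongrightarrow> L) at_top"
proof (intro exI tendstoI)
  define L where "L = (INF t\<in>{0..}. \<phi> t)"
  have bdd: "bdd_below (\<phi> ` {0..})" using lower by (auto intro!: bdd_belowI2)
  fix e :: real assume "e > 0"
  then obtain t0 where t0: "t0 \<ge> 0" "\<phi> t0 < L + e"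
    using cINF_less_iff[OF _ bdd, of "L + e"] by (auto simp: L_def)
  have "dist (\<phi> t) L < e" if "t \<ge> t0" for t
  proof -
    have "L \<le> \<phi> t" unfolding L_def using bdd that t0 by (intro cINF_lower) auto
    moreover have "\<phi> t \<le> \<phi> t0" using mono t0 that by auto
    ultimately show ?thesis using t0 by (simp add: dist_real_def)
  qed
  then show "eventually (\<lambda>t. dist (\<phi> t) (INF t\<in>{0..}. \<phi> t) < e) at_top"
    unfolding L_def by (rule eventually_at_top_linorderI)
qed

lemma continuous_norm_bound_on_compact:
  fixes F :: "'a::topological_space \<Rightarrow> 'b::real_normed_vector"
  assumes "compact K" "continuous_on K F"
  shows "\<exists>M. \<forall>x\<in>K. norm (F x) \<le> M"
  using compact_imp_bounded[OF compact_continuous_image[OF assms(2,1)]] by (auto simp: bounded_iff)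

section \<open>Potentials and flows on graphs\<close>

lemma sat_nth:
  assumes "a $ i \<le> b $ i"
  shows "sat x a b $ i = clip (a $ i) (b $ i) (x $ i)"
  using assms by (auto simp: sat_def clip_def)

lemma transpose_incidence_nth:
  assumes "directed_graph tail head"
  shows "(transpose (incidence_matrix tail head) *v p) $ e = p $ head e - p $ tail e"
proof -
  have ne: "tail e \<noteq> head e" using assms by (simp add: directed_graph_def)
  have "(transpose (incidence_matrix tail head) *v p) $ e =
      (\<Sum>i\<in>UNIV. (if head e = i then p $ i else 0) - (if tail e = i then p $ i else 0))"
    unfolding matrix_vector_mult_def transpose_def incidence_matrix_def
    using ne by (auto intro!: sum.cong)
  then show ?thesis by (simp add: sum_subtractf)
qed

lemma inner_matrix_transpose:
  fixes A :: "real^'m^'n"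
  shows "p \<bullet> (A *v z) = (transpose A *v p) \<bullet> z"
  by (simp add: dot_lmul_matrix)

lemma one_inner_incidence:
  assumes "directed_graph tail head"
  shows "1 \<bullet> (incidence_matrix tail head *v z) = (0::real)"
proof -
  have "transpose (incidence_matrix tail head) *v 1 = (0 :: real^'a)"
    by (simp add: vec_eq_iff transpose_incidence_nth[OF assms] del: transpose_matrix_vector)
  then show ?thesis by (simp add: inner_matrix_transpose del: transpose_matrix_vector)
qed

lemma incidence_axis:
  assumes "directed_graph tail head"
  shows "incidence_matrix tail head *v axis e 1 = axis (head e) 1 - axis (tail e) 1"
proof -
  have "tail e \<noteq> head e" "head e \<noteq> tail e" using assms by (auto simp: directed_graph_def dest: sym)
  then show ?thesis
  unfolding matrix_vector_mult_basis
  by (auto simp: vec_eq_iff directed_graph_def column_def incidence_matrix_def axis_def)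
qed

text \<open>
  A path from \<open>v\<close> to \<open>w\<close> carries a unit flow with source \<open>v\<close> and sink \<open>w\<close>. Restrictions on the edge
  values are allowed if they cut out a set closed under addition, such as the flows supported on a
  given edge set or a cone of feasible directions.
\<close>

lemma path_flow:
  fixes D :: "(real^'e::finite) set"
  assumes "(v, w) \<in> R\<^sup>*" and "0 \<in> D" and "\<And>h k. h \<in> D \<Longrightarrow> k \<in> D \<Longrightarrow> h + k \<in> D"
    and step: "\<And>a b. (a, b) \<in> R \<Longrightarrow> \<exists>h\<in>D. B *v h = axis b 1 - axis a (1::real)"
  shows "\<exists>h\<in>D. B *v h = axis w 1 - axis v (1::real)"
  using assms(1)
proof induction
  case base
  then show ?case using \<open>0 \<in> D\<close> by (intro bexI[of _ 0]) auto
next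
  case (step b c)
  from step.IH obtain h where h: "h \<in> D" "B *v h = axis b 1 - axis v (1::real)" by blast
  from assms(4)[OF step.hyps(2)] obtain k where k: "k \<in> D" "B *v k = axis c 1 - axis b (1::real)" by blast
  show ?case
    by (intro bexI[of _ "h + k"]) (use h k assms(3) in \<open>auto simp: matrix_vector_right_distrib\<close>)
qed

text \<open>
  A unit flow through \<open>e\<close> can be rerouted through \<open>T\<close> with the same net effect on the vertices.
\<close>

lemma connected_flow_supported:
  assumes "directed_graph tail head" and "undirected_connected tail head T"
  shows "\<exists>h. (\<forall>i. i \<notin> T \<longrightarrow> h $ i = 0) \<and>
             incidence_matrix tail head *v h = incidence_matrix tail head *v axis e 1"
proof -
  let ?D = "{h :: real^'a. \<forall>i. i \<notin> T \<longrightarrow> h $ i = 0}"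
  let ?B = "incidence_matrix tail head"
  have "\<exists>h\<in>?D. ?B *v h = axis (head e) 1 - axis (tail e) (1::real)"
  proof (rule path_flow)
    show "(tail e, head e) \<in> {(a, b). \<exists>e\<in>T. joins tail head e a b}\<^sup>*"
      using assms(2) by (simp add: undirected_connected_def)
    show "\<exists>h\<in>?D. ?B *v h = axis b 1 - axis a 1"
      if ab: "(a, b) \<in> {(a, b). \<exists>e\<in>T. joins tail head e a b}" for a b
    proof -
      obtain e where e: "e \<in> T" "joins tail head e a b" using ab by blast
      show ?thesis
      proof (cases "tail e = a \<and> head e = b")
        case True
        then show ?thesis using e
          by (intro bexI[of _ "axis e 1"]) (auto simp: incidence_axis[OF assms(1)], auto simp: axis_def)
      next
        case False
        then have "tail e = b" "head e = a" using e by (auto simp: joins_def)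
        then show ?thesis using e
          by (intro bexI[of _ "- axis e 1"])
             (auto simp: incidence_axis[OF assms(1)] vec.neg, auto simp: axis_def)
      qed
    qed
  qed auto
  then show ?thesis by (auto simp: incidence_axis[OF assms(1)])
qed

lemma connected_potential_constant:
  assumes "undirected_connected tail head T" and "\<And>e. e \<in> T \<Longrightarrow> p $ head e = p $ tail e"
  shows "p $ v = p $ w"
proof -
  have "(v, w) \<in> {(a, b). \<exists>e\<in>T. joins tail head e a b}\<^sup>*"
    using assms(1) by (simp add: undirected_connected_def)
  then show ?thesis
    by induction (use assms(2) in \<open>auto simp: joins_def\<close>)
qed

text \<open>
  The other edges of the cycle still join the two ends of the removed one.
\<close>

lemma connected_remove_cycle_edge:
  assumes conn: "undirected_connected tail head T"
    and cyc: "undirected_cycle tail head vs es" "set es \<subseteq> T"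
  shows "undirected_connected tail head (T - {es ! 0})"
proof -
  let ?R = "\<lambda>T. {(a, b). \<exists>e\<in>T. joins tail head e a b}"
  let ?T = "T - {es ! 0}"
  let ?n = "length es"
  have n: "?n > 0" using cyc by (auto simp: undirected_cycle_def)
  have sym: "sym ((?R ?T)\<^sup>*)" by (intro sym_rtrancl) (auto simp: sym_def joins_def)
  have arc: "(vs ! (1 mod ?n), vs ! (Suc k mod ?n)) \<in> (?R ?T)\<^sup>*" if "k < ?n" for k
    using that
  proof (induction k)
    case (Suc k)
    have "es ! Suc k \<in> ?T" using cyc Suc.prems n
      by (auto simp: undirected_cycle_def nth_eq_iff_index_eq subset_iff)
    moreover have "joins tail head (es ! Suc k) (vs ! Suc k) (vs ! (Suc (Suc k) mod ?n))"
      using cyc(1) Suc.prems unfolding undirected_cycle_def by blast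
    ultimately have "(vs ! Suc k, vs ! (Suc (Suc k) mod ?n)) \<in> ?R ?T" by blast
    moreover have "Suc k mod ?n = Suc k" using Suc.prems by simp
    ultimately show ?case using Suc.IH Suc.prems by (auto intro: rtrancl.rtrancl_into_rtrancl)
  qed simp
  have "Suc (?n - 1) mod ?n = 0" using n by simp
  then have around: "(vs ! (1 mod ?n), vs ! 0) \<in> (?R ?T)\<^sup>*" using arc[of "?n - 1"] n by simp
  have joins0: "joins tail head (es ! 0) (vs ! 0) (vs ! (1 mod ?n))"
    using cyc(1) n by (auto simp: undirected_cycle_def)
  have "?R T \<subseteq> (?R ?T)\<^sup>*"
  proof safe
    fix a b e assume e: "e \<in> T" "joins tail head e a b"
    show "(a, b) \<in> (?R ?T)\<^sup>*"
    proof (cases "e = es ! 0")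
      case True
      then have "a = vs ! 0 \<and> b = vs ! (1 mod ?n) \<or> b = vs ! 0 \<and> a = vs ! (1 mod ?n)"
        using e joins0 by (auto simp: joins_def)
      then show ?thesis using around sym by (auto dest: symD)
    next
      case False
      then show ?thesis using e by auto
    qed
  qed
  then have "(?R T)\<^sup>* \<subseteq> (?R ?T)\<^sup>*" by (rule rtrancl_subset_rtrancl)
  then show ?thesis using conn by (auto simp: undirected_connected_def)
qed

text \<open>
  Remove edges of cycles for as long as there is a cycle.
\<close>

lemma connected_contains_spanning_tree:
  fixes tail head :: "'e::finite \<Rightarrow> 'v"
  assumes "undirected_connected tail head S"
  shows "\<exists>T\<subseteq>S. spanning_tree tail head T"
  using finite[of S] assms
proof (induction S rule: finite_psubset_induct)
  case (psubset S)
  show ?case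
  proof (cases "\<exists>vs es. set es \<subseteq> S \<and> undirected_cycle tail head vs es")
    case False
    then show ?thesis using psubset.prems by (auto simp: spanning_tree_def)
  next
    case True
    then obtain vs es where c: "set es \<subseteq> S" "undirected_cycle tail head vs es" by blast
    then have "es ! 0 \<in> S" by (auto simp: undirected_cycle_def subset_iff)
    then have "S - {es ! 0} \<subset> S" by blast
    from psubset.IH[OF this connected_remove_cycle_edge[OF psubset.prems c(2,1)]]
    show ?thesis by blast
  qed
qed

section \<open>Gradients of strictly convex functions\<close>

lemma has_derivative_gradient:
  fixes f :: "real^'v::finite \<Rightarrow> real"
  assumes "f differentiable (at x)"
  shows "(f has_derivative (\<lambda>h. gradient f x \<bullet> h)) (at x)"
proof -
  obtain f' where f': "(f has_derivative f') (at x)" using assms by (auto simp: differentiable_def)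
  interpret bounded_linear f' using f' by (rule has_derivative_bounded_linear)
  have "partial_deriv i f x = f' (axis i 1)" for i
  proof -
    have "((\<lambda>s. x + s *\<^sub>R axis i 1) has_derivative (\<lambda>s. s *\<^sub>R axis i 1)) (at (0::real))"
      by (auto intro!: derivative_eq_intros)
    then have "((\<lambda>s. f (x + s *\<^sub>R axis i 1)) has_derivative (\<lambda>s. f' (s *\<^sub>R axis i 1))) (at 0)"
      using has_derivative_compose[of "\<lambda>s. x + s *\<^sub>R axis i 1" _ 0 UNIV f f'] f' by simp
    then have "((\<lambda>s. f (x + s *\<^sub>R axis i 1)) has_field_derivative f' (axis i 1)) (at 0)"
      unfolding has_field_derivative_def by (rule has_derivative_eq_rhs) (auto simp: scaleR)
    then show ?thesis unfolding partial_deriv_def by (rule DERIV_imp_deriv)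
  qed
  note pd = this
  have "f' h = gradient f x \<bullet> h" for h
  proof -
    have "f' h = f' (\<Sum>i\<in>UNIV. h $ i *\<^sub>R axis i 1)" by (simp add: basis_expansion scalar_mult_eq_scaleR[symmetric])
    also have "\<dots> = (\<Sum>i\<in>UNIV. h $ i * f' (axis i 1))" by (simp add: sum scaleR)
    finally show ?thesis by (simp add: inner_vec_def gradient_def pd mult.commute)
  qed
  then have "f' = (\<lambda>h. gradient f x \<bullet> h)" by (rule ext)
  then show ?thesis using f' by simp
qed

lemma strictly_convex_strict_min:
  assumes "strictly_convex H" and "\<And>x. H 0 \<le> H x" and "x \<noteq> 0"
  shows "H 0 < H x"
proof (rule ccontr)
  assume "\<not> H 0 < H x"
  then have "H x = H 0" using assms(2)[of x] by simp
  have "H ((1 - 1/2) *\<^sub>R 0 + (1/2) *\<^sub>R x) < (1 - 1/2) * H 0 + (1/2) * H x"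
    using assms(1)[unfolded strictly_convex_def, rule_format, of 0 x "1 / 2"] assms(3) by simp
  then show False using assms(2)[of "(1 - 1/2) *\<^sub>R 0 + (1/2) *\<^sub>R x"] \<open>H x = H 0\<close> by simp
qed

text \<open>
  The minimum of \<open>H\<close> over the unit sphere exceeds \<open>H 0\<close>, and a convex function grows at least linearly
  beyond the sphere.
\<close>

lemma strictly_convex_coercive:
  fixes H :: "'a::euclidean_space \<Rightarrow> real"
  assumes sc: "strictly_convex H" and min: "\<And>x. H 0 \<le> H x" and cont: "continuous_on UNIV H"
  shows "\<exists>\<mu>>0. \<forall>x. norm x \<ge> 1 \<longrightarrow> \<mu> * norm x \<le> H x - H 0"
proof -
  let ?S = "sphere (0::'a) 1"
  have "compact ?S" "?S \<noteq> {}" by auto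
  from continuous_attains_inf[OF this continuous_on_subset[OF cont]]
  obtain m where m: "m \<in> ?S" "\<And>x. x \<in> ?S \<Longrightarrow> H m \<le> H x" by auto
  have "m \<noteq> 0" using m(1) by auto
  then have pos: "H m - H 0 > 0" using strictly_convex_strict_min[OF sc min] by simp
  have "(H m - H 0) * norm x \<le> H x - H 0" if "norm x \<ge> 1" for x
  proof (cases "norm x = 1")
    case True
    then show ?thesis using m(2)[of x] by simp
  next
    case False
    define t where "t = 1 / norm x"
    have "norm x > 1" using that False by simp
    then have t: "0 < t" "t < 1" by (auto simp: t_def divide_less_eq)
    have "x \<noteq> 0" using that by auto
    then have "H ((1 - t) *\<^sub>R 0 + t *\<^sub>R x) < (1 - t) * H 0 + t * H x"
      using sc[unfolded strictly_convex_def, rule_format, of 0 x t] t by simp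
    moreover have "H m \<le> H (t *\<^sub>R x)" using \<open>x \<noteq> 0\<close> by (intro m(2)) (simp add: t_def)
    ultimately have "H m - H 0 < t * (H x - H 0)" by (simp add: algebra_simps)
    then have "(H m - H 0) * norm x < t * (H x - H 0) * norm x"
      using \<open>x \<noteq> 0\<close> by (intro mult_strict_right_mono) auto
    then show ?thesis using \<open>x \<noteq> 0\<close> by (simp add: t_def)
  qed
  with pos show ?thesis by blast
qed

text \<open>
  The derivative of \<open>H\<close> at \<open>x\<close> in the direction of the minimum is at most \<open>H 0 - H x\<close>, by convexity, and
  this is negative.
\<close>

lemma gradient_inner_pos:
  fixes H :: "real^'v::finite \<Rightarrow> real"
  assumes sc: "strictly_convex H" and min: "\<And>x. H 0 \<le> H x" and "H differentiable (at x)" and "x \<noteq> 0"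
  shows "0 < gradient H x \<bullet> x"
proof (rule ccontr)
  assume neg: "\<not> 0 < gradient H x \<bullet> x"
  let ?\<phi> = "\<lambda>s::real. H (x + s *\<^sub>R (- x)) - H x + s * (H x - H 0)"
  have "((\<lambda>s. x + s *\<^sub>R (- x)) has_derivative (\<lambda>s. s *\<^sub>R (- x))) (at (0::real))"
    by (auto intro!: derivative_eq_intros)
  then have "((\<lambda>s. H (x + s *\<^sub>R (- x))) has_derivative (\<lambda>s. gradient H x \<bullet> (s *\<^sub>R (- x)))) (at 0)"
    using has_derivative_compose[of "\<lambda>s. x + s *\<^sub>R (- x)" "\<lambda>s. s *\<^sub>R (- x)" 0 UNIV H "(\<bullet>) (gradient H x)"]
      has_derivative_gradient[OF assms(3)] by simp
  then have "(?\<phi> has_real_derivative (- (gradient H x \<bullet> x) + (H x - H 0))) (at 0)"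
    by (auto intro!: derivative_eq_intros simp: has_field_derivative_def algebra_simps)
  moreover have "0 < - (gradient H x \<bullet> x) + (H x - H 0)"
    using neg strictly_convex_strict_min[OF sc min \<open>x \<noteq> 0\<close>] by simp
  ultimately obtain d where d: "d > 0" "\<And>h. 0 < h \<Longrightarrow> h < d \<Longrightarrow> ?\<phi> 0 < ?\<phi> (0 + h)"
    using DERIV_pos_inc_right by blast
  define h where "h = min (d / 2) (1 / 2)"
  have h: "0 < h" "h < d" "h < 1" using d(1) by (auto simp: h_def)
  have "H ((1 - h) *\<^sub>R x + h *\<^sub>R 0) < (1 - h) * H x + h * H 0"
    using sc[unfolded strictly_convex_def, rule_format, of x 0 h] h \<open>x \<noteq> 0\<close> by simp
  moreover have "(1 - h) *\<^sub>R x + h *\<^sub>R 0 = x + h *\<^sub>R (- x)" by (simp add: algebra_simps)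
  ultimately show False using d(2)[OF h(1,2)] by (simp add: algebra_simps)
qed

section \<open>Existence of solutions of differential equations\<close>

primrec euler_node :: "(real \<Rightarrow> 'a \<Rightarrow> 'a) \<Rightarrow> real \<Rightarrow> 'a \<Rightarrow> nat \<Rightarrow> 'a::real_vector" where
  "euler_node f h x0 0 = x0"
| "euler_node f h x0 (Suc j) = euler_node f h x0 j + h *\<^sub>R f (real j * h) (euler_node f h x0 j)"

abbreviation euler_slope :: "(real \<Rightarrow> 'a \<Rightarrow> 'a) \<Rightarrow> real \<Rightarrow> 'a \<Rightarrow> nat \<Rightarrow> 'a::real_vector" where
  "euler_slope f h x0 j \<equiv> f (real j * h) (euler_node f h x0 j)"

text \<open>
  The \<open>j\<close>-th step contributes its slope for the time that \<open>{0..t}\<close> spends in \<open>{j h..(j + 1) h}\<close>, which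
  is \<open>clip 0 h (t - j h)\<close>. The same formula holds for all \<open>t\<close> at once, so increments between
  any two times are weighted sums of slopes.
\<close>

definition euler_polygon :: "(real \<Rightarrow> 'a \<Rightarrow> 'a) \<Rightarrow> real \<Rightarrow> 'a \<Rightarrow> real \<Rightarrow> 'a::real_vector" where
  "euler_polygon f h x0 t =
     x0 + (\<Sum>j<nat \<lceil>t / h\<rceil>. clip 0 h (t - real j * h) *\<^sub>R euler_slope f h x0 j)"

lemma euler_polygon_eq:
  assumes "h > 0" and "t \<le> real K * h"
  shows "euler_polygon f h x0 t = x0 + (\<Sum>j<K. clip 0 h (t - real j * h) *\<^sub>R euler_slope f h x0 j)"
proof -
  have "t / h \<le> real K" using assms by (simp add: divide_le_eq)
  then have "nat \<lceil>t / h\<rceil> \<le> K" by linarith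
  moreover have "clip 0 h (t - real j * h) = 0" if "nat \<lceil>t / h\<rceil> \<le> j" for j
  proof -
    have "t / h \<le> real j" using that by linarith
    then have "t \<le> real j * h" using assms(1) by (simp add: divide_le_eq)
    then show ?thesis using assms(1) by (simp add: clip_def)
  qed
  ultimately show ?thesis unfolding euler_polygon_def
    by (intro arg_cong2[where f = "(+)"] refl sum.mono_neutral_left) auto
qed

lemma euler_polygon_node:
  assumes "h > 0"
  shows "euler_polygon f h x0 (real k * h) = euler_node f h x0 k"
proof -
  have "euler_node f h x0 k = x0 + (\<Sum>j<k. h *\<^sub>R euler_slope f h x0 j)"
    by (induction k) auto
  moreover have "clip 0 h (real k * h - real j * h) = h" if "j < k" for j
  proof -
    have "1 * h \<le> (real k - real j) * h" using that assms by (intro mult_right_mono) auto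
    then show ?thesis using assms by (simp add: clip_def algebra_simps)
  qed
  ultimately show ?thesis using assms by (simp add: euler_polygon_eq[of h _ k])
qed

lemma sum_clip_steps:
  assumes "h \<ge> 0"
  shows "(\<Sum>j<K. clip 0 h (t - real j * h)) = clip 0 (real K * h) t"
proof (induction K)
  case (Suc K)
  have "clip 0 x t + clip 0 h (t - x) = clip 0 (x + h) t" if "0 \<le> x" for x
    using assms that by (auto simp: clip_def max_def min_def)
  from this[of "real K * h"] have "clip 0 (real K * h) t + clip 0 h (t - real K * h) = clip 0 (real K * h + h) t"
    using assms by simp
  then show ?case using Suc by (simp add: algebra_simps)
qed (simp add: clip_def)

text \<open>
  The increment is a combination of slopes whose weights are nonnegative and sum to \<open>t - s\<close>, and only
  steps that meet the interval have positive weight.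
\<close>

lemma euler_polygon_increment:
  fixes f :: "real \<Rightarrow> 'a \<Rightarrow> 'a::real_normed_vector"
  assumes h: "h > 0" and st: "0 \<le> s" "s \<le> t"
    and slope: "\<And>j. real j * h < t \<Longrightarrow> s < real j * h + h \<Longrightarrow> norm (euler_slope f h x0 j - v) \<le> \<epsilon>"
  shows "norm (euler_polygon f h x0 t - euler_polygon f h x0 s - (t - s) *\<^sub>R v) \<le> \<epsilon> * (t - s)"
proof -
  define K where "K = nat \<lceil>t / h\<rceil>"
  have "t / h \<le> real K" unfolding K_def by linarith
  then have K: "t \<le> real K * h" using h by (simp add: divide_le_eq)
  define w where "w j = clip 0 h (t - real j * h) - clip 0 h (s - real j * h)" for j
  have w0: "0 \<le> w j" for j using clip_mono[of "s - real j * h" "t - real j * h" 0 h] st by (simp add: w_def)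
  have "(\<Sum>j<K. w j) = clip 0 (real K * h) t - clip 0 (real K * h) s"
    using h unfolding w_def sum_subtractf by (simp add: sum_clip_steps)
  also have "\<dots> = t - s" using K st by (simp add: clip_def)
  finally have sumw: "(\<Sum>j<K. w j) = t - s" .
  have "euler_polygon f h x0 t - euler_polygon f h x0 s - (t - s) *\<^sub>R v =
      (\<Sum>j<K. w j *\<^sub>R (euler_slope f h x0 j - v))"
    unfolding sumw[symmetric]
    using K st h by (simp add: euler_polygon_eq[of h _ K] w_def algebra_simps sum_subtractf scaleR_sum_left sum.distrib)
  also have "norm \<dots> \<le> (\<Sum>j<K. \<epsilon> * w j)"
  proof (rule order_trans[OF norm_sum sum_mono])
    fix j
    show "norm (w j *\<^sub>R (euler_slope f h x0 j - v)) \<le> \<epsilon> * w j"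
    proof (cases "real j * h < t \<and> s < real j * h + h")
      case True
      then show ?thesis using slope[of j] w0[of j] by (simp add: mult.commute[of \<epsilon>] mult_left_mono)
    next
      case False
      then have "w j = 0" using h st by (auto simp: w_def clip_def)
      then show ?thesis by simp
    qed
  qed
  also have "\<dots> = \<epsilon> * (t - s)" by (simp add: sum_distrib_left[symmetric] sumw)
  finally show ?thesis .
qed

text \<open>
  Tychonoff's theorem. The cluster point is taken in the product topology, so the sequence comes close
  to it at any two prescribed times simultaneously; this is all that is needed to pass to the limit in
  an estimate of an increment.
\<close>

lemma cluster_point_pointwise:
  fixes P :: "nat \<Rightarrow> 'a \<Rightarrow> 'b::heine_borel"
  assumes "\<And>n t. P n t \<in> cball (c t) (r t)"
  obtains X where "\<And>t. X t \<in> cball (c t) (r t)"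
    and "\<And>s t \<kappa> N. \<kappa> > 0 \<Longrightarrow> \<exists>n\<ge>N. dist (P n s) (X s) < \<kappa> \<and> dist (P n t) (X t) < \<kappa>"
proof -
  let ?S = "PiE UNIV (\<lambda>t. cball (c t) (r t))"
  have "compactin (product_topology (\<lambda>_. euclidean) UNIV) ?S"
    unfolding compactin_PiE by auto
  then have "compact ?S" by (simp add: euclidean_product_topology)
  moreover have "filtermap P sequentially \<noteq> bot" by (simp add: filtermap_bot_iff)
  moreover have "eventually (\<lambda>Y. Y \<in> ?S) (filtermap P sequentially)"
    unfolding eventually_filtermap using assms by (intro always_eventually) auto
  ultimately obtain X where X: "X \<in> ?S" "inf (nhds X) (filtermap P sequentially) \<noteq> bot"
    unfolding compact_filter by metis
  have "\<exists>n\<ge>N. dist (P n s) (X s) < \<kappa> \<and> dist (P n t) (X t) < \<kappa>" if "\<kappa> > 0" for s t \<kappa> N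
  proof (rule ccontr)
    assume neg: "\<not> ?thesis"
    let ?U = "{Y. dist (Y s) (X s) < \<kappa> \<and> dist (Y t) (X t) < \<kappa>}"
    have "open ?U"
      by (intro open_Collect_conj open_Collect_less continuous_on_dist continuous_on_const
          continuous_on_product_coordinates)
    then have "eventually (\<lambda>Y. Y \<in> ?U) (nhds X)" using that by (intro eventually_nhds_in_open) auto
    moreover have "eventually (\<lambda>Y. Y \<notin> ?U) (filtermap P sequentially)"
      unfolding eventually_filtermap using neg by (intro eventually_sequentiallyI[of N]) auto
    ultimately have "eventually (\<lambda>_. False) (inf (nhds X) (filtermap P sequentially))"
      unfolding eventually_inf by blast
    then show False using X(2) by (simp add: trivial_limit_def[symmetric])
  qed
  with X(1) show ?thesis by (intro that[of X]) auto
qed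

text \<open>
  Euler polygons with step \<open>h \<longlongrightarrow> 0\<close> share a local Lipschitz constant. Near a time \<open>t\<close> all nodes of a
  polygon that passes close to \<open>(t, X t)\<close> stay close to that point, so by continuity of \<open>f\<close> all slopes are close
  to \<open>f t (X t)\<close>. The resulting estimate of increments passes to the cluster point \<open>X\<close> and states that
  \<open>X\<close> has derivative \<open>f t (X t)\<close>.
\<close>

theorem peano_global:
  fixes f :: "real \<Rightarrow> 'a \<Rightarrow> 'a::euclidean_space"
  assumes cont: "continuous_on ({0..} \<times> UNIV) (\<lambda>(t, x). f t x)"
    and bounded: "\<And>T. \<exists>M. \<forall>t\<in>{0..T}. \<forall>x. norm (f t x) \<le> M"
  shows "\<exists>X. X 0 = x0 \<and> (\<forall>t\<ge>0. (X has_vector_derivative f t (X t)) (at t within {0..}))"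
proof -
  obtain M where M: "\<And>T t x. 0 \<le> t \<Longrightarrow> t \<le> T \<Longrightarrow> norm (f t x) \<le> M T"
    using bounded by (metis atLeastAtMost_iff)
  have M_nonneg: "0 \<le> M T" if "0 \<le> T" for T using order_trans[OF norm_ge_zero M[OF that order_refl]] .
  define h where "h n = 1 / real (Suc n)" for n
  have h: "h n > 0" for n by (simp add: h_def)
  define P where "P n = euler_polygon f (h n) x0" for n
  have lip: "norm (P n t - P n s) \<le> M T * (t - s)" if "0 \<le> s" "s \<le> t" "t \<le> T" for n s t T
  proof -
    have "norm (P n t - P n s - (t - s) *\<^sub>R 0) \<le> M T * (t - s)"
      unfolding P_def
    proof (rule euler_polygon_increment[OF h that(1,2)])
      fix j assume "real j * h n < t"
      then show "norm (euler_slope f (h n) x0 j - 0) \<le> M T"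
        using M[of "real j * h n" T] h[of n] that(3) by simp
    qed
    then show ?thesis by simp
  qed
  have P0: "P n t = x0" if "t \<le> 0" for n t
    using euler_polygon_eq[OF h, of t 0 n f x0] that by (simp add: P_def)
  define r where "r t = (if 0 \<le> t then M t * t else 0)" for t
  have "P n t \<in> cball x0 (r t)" for n t
    using lip[of 0 t t n] P0[of 0 n] P0[of t n] by (auto simp: r_def dist_norm norm_minus_commute)
  then obtain X where X: "\<And>t. X t \<in> cball x0 (r t)"
    and cluster: "\<And>s t \<kappa> N. \<kappa> > 0 \<Longrightarrow> \<exists>n\<ge>N. dist (P n s) (X s) < \<kappa> \<and> dist (P n t) (X t) < \<kappa>"
    using cluster_point_pointwise[of P "\<lambda>_. x0" r] by metis
  have "(X has_vector_derivative f t (X t)) (at t within {0..})" if t: "0 \<le> t" for t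
    unfolding has_vector_derivative_def has_derivative_within_alt
  proof (intro conjI allI impI)
    show "bounded_linear (\<lambda>s. s *\<^sub>R f t (X t))" by (rule bounded_linear_scaleR_left)
    fix e :: real assume "e > 0"
    let ?v = "f t (X t)" and ?M = "M (t + 1)"
    have M0: "0 \<le> ?M" using M_nonneg t by simp
    have "(t, X t) \<in> {0..} \<times> UNIV" using t by simp
    then obtain \<delta> where \<delta>: "\<delta> > 0"
      "\<And>s y. s \<ge> 0 \<Longrightarrow> dist (s, y) (t, X t) < \<delta> \<Longrightarrow> dist (f s y) ?v < e"
      using cont[unfolded continuous_on_iff, rule_format, of "(t, X t)" e] \<open>e > 0\<close> by auto
    \<comment> \<open>Nodes that matter lie within time \<open>2 d\<close> of \<open>t\<close>, hence within \<open>2 d (?M + 1) \<le> \<delta> / 2\<close> of the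
      point of the polygon above \<open>t\<close>, which is itself within \<open>\<delta> / 4\<close> of \<open>X t\<close>.\<close>
    define d where "d = min 1 (\<delta> / (4 * (?M + 1)))"
    have d: "d > 0" "d \<le> 1" "(?M + 1) * d \<le> \<delta> / 4"
    proof -
      show "d > 0" "d \<le> 1" using \<delta>(1) M0 by (auto simp: d_def)
      have "(?M + 1) * d \<le> (?M + 1) * (\<delta> / (4 * (?M + 1)))"
        using M0 by (intro mult_left_mono) (auto simp: d_def)
      also have "\<dots> = \<delta> / 4" using M0 by (simp add: field_simps)
      finally show "(?M + 1) * d \<le> \<delta> / 4" .
    qed
    obtain N where N: "\<And>n. n \<ge> N \<Longrightarrow> h n < d"
    proof -
      obtain N where "1 / real (Suc N) < d" using d(1) nat_approx_posE by blast
      moreover have "h n \<le> 1 / real (Suc N)" if "n \<ge> N" for n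
        using that by (simp add: h_def frac_le)
      ultimately show ?thesis by (intro that[of N]) (meson le_less_trans)
    qed
    have approx: "norm (P n b - P n a - (b - a) *\<^sub>R ?v) \<le> e * (b - a)"
      if n: "n \<ge> N" "dist (P n t) (X t) < \<delta> / 4" and ab: "0 \<le> a" "a \<le> b" "t - d \<le> a" "b \<le> t + d" "a \<le> t" "t \<le> b"
      for n a b
      unfolding P_def
    proof (rule euler_polygon_increment[OF h ab(1,2)])
      fix j assume j: "real j * h n < b" "a < real j * h n + h n"
      let ?s = "real j * h n"
      have s: "0 \<le> ?s" "?s \<le> t + 1" "\<bar>?s - t\<bar> \<le> 2 * d"
        using j N[OF n(1)] ab d h[of n] by (auto simp: abs_le_iff)
      have node: "euler_node f (h n) x0 j = P n ?s" by (simp add: P_def euler_polygon_node[OF h])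
      have "norm (P n ?s - P n t) \<le> ?M * \<bar>?s - t\<bar>"
        using lip[of "?s" t "t + 1" n] lip[of t "?s" "t + 1" n] s t
        by (cases "?s \<le> t") (auto simp: norm_minus_commute)
      also have "\<dots> \<le> ?M * (2 * d)" using s M0 by (intro mult_left_mono) auto
      finally have "dist (P n ?s) (P n t) \<le> ?M * (2 * d)" by (simp add: dist_norm)
      then have "dist (P n ?s) (X t) < ?M * (2 * d) + \<delta> / 4"
        using dist_triangle[of "P n ?s" "X t" "P n t"] n(2) by linarith
      moreover have "dist (?s, P n ?s) (t, X t) \<le> \<bar>?s - t\<bar> + dist (P n ?s) (X t)"
        unfolding dist_Pair_Pair using sqrt_sum_squares_le_sum_abs[of "dist ?s t" "dist (P n ?s) (X t)"]
        by (simp add: dist_real_def)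
      moreover have "?M * (2 * d) + 2 * d \<le> \<delta> / 2" using d(3) by (simp add: algebra_simps)
      ultimately have "dist (?s, P n ?s) (t, X t) < \<delta>" using s \<delta>(1) by linarith
      from \<delta>(2)[OF s(1) this] show "norm (euler_slope f (h n) x0 j - ?v) \<le> e"
        by (simp add: node dist_norm)
    qed
    have limit: "norm (X b - X a - (b - a) *\<^sub>R ?v) \<le> e * (b - a)"
      if ab: "0 \<le> a" "a \<le> b" "t - d \<le> a" "b \<le> t + d" "a = t \<or> b = t" for a b
    proof (rule field_le_epsilon)
      fix \<kappa> :: real assume "\<kappa> > 0"
      define \<kappa>' where "\<kappa>' = min (\<kappa> / 2) (\<delta> / 4)"
      have "\<kappa>' > 0" using \<open>\<kappa> > 0\<close> \<delta>(1) by (simp add: \<kappa>'_def)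
      from cluster[OF this, of N a b] obtain n where
        n: "n \<ge> N" "dist (P n a) (X a) < \<kappa>'" "dist (P n b) (X b) < \<kappa>'" by blast
      have "norm (P n b - P n a - (b - a) *\<^sub>R ?v) \<le> e * (b - a)"
        by (rule approx) (use n ab in \<open>auto simp: \<kappa>'_def\<close>)
      moreover have "norm (X b - P n b) < \<kappa> / 2" "norm (P n a - X a) < \<kappa> / 2"
        using n by (auto simp: \<kappa>'_def dist_norm norm_minus_commute)
      moreover have "X b - X a - (b - a) *\<^sub>R ?v = (P n b - P n a - (b - a) *\<^sub>R ?v) + ((X b - P n b) + (P n a - X a))"
        by simp
      then have "norm (X b - X a - (b - a) *\<^sub>R ?v) \<le>
          norm (P n b - P n a - (b - a) *\<^sub>R ?v) + (norm (X b - P n b) + norm (P n a - X a))"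
        by (simp only:) (rule order_trans[OF norm_triangle_ineq add_left_mono[OF norm_triangle_ineq]])
      ultimately show "norm (X b - X a - (b - a) *\<^sub>R ?v) \<le> e * (b - a) + \<kappa>" by linarith
    qed
    show "\<exists>d>0. \<forall>s\<in>{0..}. norm (s - t) < d \<longrightarrow> norm (X s - X t - (s - t) *\<^sub>R ?v) \<le> e * norm (s - t)"
    proof (intro exI[of _ d] conjI ballI impI d(1))
      fix s :: real assume s: "s \<in> {0..}" "norm (s - t) < d"
      show "norm (X s - X t - (s - t) *\<^sub>R ?v) \<le> e * norm (s - t)"
      proof (cases "t \<le> s")
        case True
        then show ?thesis using limit[of t s] s t d by auto
      next
        case False
        have "norm (X s - X t - (s - t) *\<^sub>R ?v) = norm (- (X t - X s - (t - s) *\<^sub>R ?v))"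
          by (simp add: algebra_simps)
        also have "\<dots> = norm (X t - X s - (t - s) *\<^sub>R ?v)" by (rule norm_minus_cancel)
        finally show ?thesis using limit[of s t] False s t d by auto
      qed
    qed
  qed
  moreover have "X 0 = x0" using X[of 0] by (simp add: r_def)
  ultimately show ?thesis by blast
qed

section \<open>The flow network\<close>

text \<open>
  The tension is stated with a transpose; the simplifier is to leave it in this form.
\<close>

declare transpose_matrix_vector [simp del]

locale flow_network =
  fixes tail head :: "'e::finite \<Rightarrow> 'v::finite"
    and um up :: "real^'e"
    and H :: "real^'v \<Rightarrow> real"
  assumes graph: "directed_graph tail head"
    and bounds: "\<And>i. um $ i \<le> up $ i"
    and convex: "strictly_convex H"
    and differentiable: "\<And>x. H differentiable (at x)"
    and gradient_continuous: "continuous_on UNIV (gradient H)"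
    and minimum: "\<And>x. H 0 \<le> H x"
begin

abbreviation B where "B \<equiv> incidence_matrix tail head"

abbreviation g where "g x \<equiv> sat x um up"

abbreviation tension where "tension x \<equiv> transpose B *v gradient H x"

lemma g_nth: "g x $ i = clip (um $ i) (up $ i) (x $ i)"
  by (rule sat_nth[OF bounds])

lemma H_continuous: "continuous_on UNIV H"
  by (intro continuous_at_imp_continuous_on ballI differentiable_imp_continuous_within differentiable)

lemma continuous_gradient: "continuous_on S f \<Longrightarrow> continuous_on S (\<lambda>x. gradient H (f x))"
  using continuous_on_compose2[OF gradient_continuous] by auto

lemma continuous_mult_vec: "continuous_on S f \<Longrightarrow> continuous_on S (\<lambda>x. A *v f x)"
  for A :: "real^'n::finite^'m::finite"
  by (rule bounded_linear.continuous_on[OF matrix_vector_mul_bounded_linear])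

lemma continuous_tension: "continuous_on S f \<Longrightarrow> continuous_on S (\<lambda>x. tension (f x))"
  by (intro continuous_mult_vec continuous_gradient)

lemma continuous_clip: "continuous_on S f \<Longrightarrow> continuous_on S (\<lambda>x. clip a b (f x))"
  using continuous_on_compose2[OF clip_continuous[of UNIV]] by auto

lemma continuous_g: "continuous_on S f \<Longrightarrow> continuous_on S (\<lambda>x. g (f x))"
proof -
  assume f: "continuous_on S f"
  have "(\<lambda>x. g (f x)) = (\<lambda>x. \<chi> i. clip (um $ i) (up $ i) (f x $ i))"
    by (auto simp: vec_eq_iff g_nth)
  then show ?thesis
    by (simp only:) (intro continuous_on_vec_lambda continuous_clip continuous_on_component f)
qed

end

section \<open>Convergence under the interior point condition\<close>

text \<open>
  A trajectory together with a witness of the interior point condition: the circulation \<open>z\<close> and a connected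
  set \<open>T\<close> of edges on which it is interior.
\<close>

locale closed_loop = flow_network tail head um up H
  for tail head :: "'e::finite \<Rightarrow> 'v::finite" and um up :: "real^'e" and H :: "real^'v \<Rightarrow> real" +
  fixes q :: "real \<Rightarrow> real^'v" and c :: "real \<Rightarrow> real^'e" and z :: "real^'e" and T :: "'e set"
  assumes q_der: "\<And>t. 0 \<le> t \<Longrightarrow>
      (q has_vector_derivative B *v g (- tension (q t) - c t)) (at t within {0..})"
    and c_der: "\<And>t. 0 \<le> t \<Longrightarrow> (c has_vector_derivative tension (q t)) (at t within {0..})"
    and balanced: "1 \<bullet> q 0 = 0"
    and z_in: "\<And>i. z $ i \<in> {um $ i..up $ i}"
    and circulation: "B *v z = 0"
    and interior: "\<And>i. i \<in> T \<Longrightarrow> um $ i < z $ i \<and> z $ i < up $ i"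
    and connected: "undirected_connected tail head T"
begin

text \<open>
  The \<open>i\<close>-th term is convex in \<open>c\<^sub>i\<close> with slope \<open>z\<^sub>i - g\<^sub>i(-c\<^sub>i)\<close>. Thus it is bounded below because
  \<open>z\<^sub>i\<close> lies in the interval, and coercive if \<open>z\<^sub>i\<close> lies in its interior.
\<close>

definition lyapunov where
  "lyapunov t = H (q t) + (\<Sum>i\<in>UNIV. clip_primitive (um $ i) (up $ i) (- c t $ i) + z $ i * c t $ i)"

text \<open>
  The power lost on edge \<open>i\<close> at the state \<open>s = (q, c)\<close>.
\<close>

definition dissipation where
  "dissipation i s = tension (fst s) $ i * (clip (um $ i) (up $ i) (- snd s $ i)
     - clip (um $ i) (up $ i) (- snd s $ i - tension (fst s) $ i))"

lemma dissipation_lower: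
  "(clip (um $ i) (up $ i) (- snd s $ i) - clip (um $ i) (up $ i) (- snd s $ i - tension (fst s) $ i))\<^sup>2
    \<le> dissipation i s"
  using clip_diff_mult[of "um $ i" "up $ i" "- snd s $ i" "- snd s $ i - tension (fst s) $ i"]
  by (simp add: dissipation_def)

lemma dissipation_nonneg: "0 \<le> dissipation i s"
  by (rule order_trans[OF _ dissipation_lower]) simp

lemma continuous_dissipation: "continuous_on UNIV (dissipation i)"
  unfolding dissipation_def
  by (intro continuous_intros continuous_clip continuous_on_component continuous_tension
      continuous_on_fst continuous_on_snd continuous_on_id)

lemma c_nth_der:
  assumes "0 \<le> t"
  shows "((\<lambda>t. c t $ i) has_real_derivative tension (q t) $ i) (at t within {0..})"
  using bounded_linear.has_vector_derivative[OF bounded_linear_vec_nth c_der[OF assms]]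
  by (simp add: has_real_derivative_iff_has_vector_derivative)

text \<open>
  The power supplied to the vertices is \<open>\<nabla>H \<bullet> B g(-d - c) = d \<bullet> g(-d - c)\<close>, the controller terms
  contribute \<open>-d \<bullet> g(-c)\<close>, and the terms with \<open>z\<close> cancel as \<open>z\<close> is a circulation.
\<close>

lemma lyapunov_der:
  assumes "0 \<le> t"
  shows "(lyapunov has_real_derivative - (\<Sum>i\<in>UNIV. dissipation i (q t, c t))) (at t within {0..})"
proof -
  let ?d = "tension (q t)" and ?y = "g (- tension (q t) - c t)"
  have "((\<lambda>t. H (q t)) has_derivative (\<lambda>s. gradient H (q t) \<bullet> (s *\<^sub>R (B *v ?y)))) (at t within {0..})"
    using has_derivative_compose[OF q_der[OF assms, unfolded has_vector_derivative_def]
        has_derivative_gradient[OF differentiable]] .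
  then have hH: "((\<lambda>t. H (q t)) has_real_derivative gradient H (q t) \<bullet> (B *v ?y)) (at t within {0..})"
    unfolding has_field_derivative_def by (rule has_derivative_eq_rhs) auto
  have hs: "((\<lambda>t. clip_primitive (um $ i) (up $ i) (- c t $ i) + z $ i * c t $ i) has_real_derivative
      clip (um $ i) (up $ i) (- c t $ i) * (- ?d $ i) + z $ i * ?d $ i) (at t within {0..})" for i
    by (intro DERIV_add DERIV_cmult c_nth_der assms DERIV_chain2[OF clip_primitive_derivative[OF bounds]]
        DERIV_minus)
  have "(lyapunov has_real_derivative gradient H (q t) \<bullet> (B *v ?y) +
     (\<Sum>i\<in>UNIV. clip (um $ i) (up $ i) (- c t $ i) * (- ?d $ i) + z $ i * ?d $ i)) (at t within {0..})"
    unfolding lyapunov_def[abs_def] by (rule DERIV_add[OF hH DERIV_sum[OF hs]])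
  moreover have "gradient H (q t) \<bullet> (B *v ?y) = (\<Sum>i\<in>UNIV. ?d $ i * ?y $ i)"
    unfolding inner_matrix_transpose by (simp add: inner_vec_def)
  moreover have "(\<Sum>i\<in>UNIV. z $ i * ?d $ i) = 0"
  proof -
    have "(\<Sum>i\<in>UNIV. z $ i * ?d $ i) = ?d \<bullet> z" by (simp add: inner_vec_def mult.commute)
    also have "\<dots> = gradient H (q t) \<bullet> (B *v z)" by (simp add: inner_matrix_transpose)
    finally show ?thesis by (simp add: circulation)
  qed
  moreover have "(\<Sum>i\<in>UNIV. ?d $ i * ?y $ i) + (\<Sum>i\<in>UNIV. clip (um $ i) (up $ i) (- c t $ i) * (- ?d $ i))
      = - (\<Sum>i\<in>UNIV. dissipation i (q t, c t))"
    unfolding sum.distrib[symmetric] sum_negf[symmetric]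
  proof (rule sum.cong[OF refl])
    fix i
    have y: "?y $ i = clip (um $ i) (up $ i) (- c t $ i - ?d $ i)"
      by (simp add: g_nth minus_diff_commute[of "?d $ i"])
    show "?d $ i * ?y $ i + clip (um $ i) (up $ i) (- c t $ i) * (- ?d $ i) = - dissipation i (q t, c t)"
      unfolding y dissipation_def by (simp add: right_diff_distrib mult.commute)
  qed
  ultimately show ?thesis by (simp add: sum.distrib sum_subtractf sum_negf)
qed

lemma lyapunov_antimono:
  assumes "0 \<le> s" "s \<le> t"
  shows "lyapunov t \<le> lyapunov s"
proof (rule DERIV_nonpos_imp_decreasing_open[OF assms(2)])
  fix x assume x: "s < x" "x < t"
  then have "at x within {0..} = at x" using assms(1) by (intro at_within_interior) auto
  then show "\<exists>y. (lyapunov has_real_derivative y) (at x) \<and> y \<le> 0"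
    using lyapunov_der[of x] x assms(1) dissipation_nonneg
    by (intro exI[of _ "- (\<Sum>i\<in>UNIV. dissipation i (q x, c x))"]) (auto intro: sum_nonneg)
next
  have "continuous_on {0..} lyapunov"
    unfolding continuous_on_eq_continuous_within by (intro ballI DERIV_continuous[OF lyapunov_der]) simp
  then show "continuous_on {s..t} lyapunov" by (rule continuous_on_subset) (use assms(1) in auto)
qed

lemma lyapunov_term_lower:
  "- (z $ i)\<^sup>2 / 2 \<le> clip_primitive (um $ i) (up $ i) (- c t $ i) + z $ i * c t $ i"
  using clip_primitive_ge[OF z_in[of i], of "- c t $ i"] by (simp add: algebra_simps)

text \<open>
  An upper bound for the excess of \<open>H\<close> over its minimum and for each controller term, since the other
  controller terms are at least \<open>-z\<^sub>i\<^sup>2 / 2\<close>.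
\<close>

definition energy_budget where "energy_budget = lyapunov 0 - H 0 + (\<Sum>i\<in>UNIV. (z $ i)\<^sup>2 / 2)"

lemma lyapunov_lower: "H 0 - (\<Sum>i\<in>UNIV. (z $ i)\<^sup>2 / 2) \<le> lyapunov t"
proof -
  have "(\<Sum>i\<in>UNIV. - (z $ i)\<^sup>2 / 2) \<le> (\<Sum>i\<in>UNIV. clip_primitive (um $ i) (up $ i) (- c t $ i) + z $ i * c t $ i)"
    by (intro sum_mono lyapunov_term_lower)
  then show ?thesis using minimum[of "q t"] by (simp add: lyapunov_def sum_negf)
qed

lemma lyapunov_parts_bounded:
  assumes "0 \<le> t"
  shows "H (q t) - H 0 \<le> energy_budget"
    and "clip_primitive (um $ i) (up $ i) (- c t $ i) + z $ i * c t $ i \<le> energy_budget"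
proof -
  let ?F = "\<lambda>i. clip_primitive (um $ i) (up $ i) (- c t $ i) + z $ i * c t $ i"
  have nn: "0 \<le> ?F i + (z $ i)\<^sup>2 / 2" for i using lyapunov_term_lower[of i t] by simp
  have tot: "H (q t) - H 0 + (\<Sum>i\<in>UNIV. ?F i + (z $ i)\<^sup>2 / 2) \<le> energy_budget"
    using lyapunov_antimono[OF order_refl assms] unfolding energy_budget_def lyapunov_def[of t] by (simp add: sum.distrib)
  have "0 \<le> (\<Sum>i\<in>UNIV. ?F i + (z $ i)\<^sup>2 / 2)" by (intro sum_nonneg nn)
  then show "H (q t) - H 0 \<le> energy_budget" using tot by linarith
  have "?F i + (z $ i)\<^sup>2 / 2 \<le> (\<Sum>i\<in>UNIV. ?F i + (z $ i)\<^sup>2 / 2)"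
    by (rule member_le_sum) (use nn in auto)
  moreover have "0 \<le> (z $ i)\<^sup>2 / 2" by simp
  ultimately show "?F i \<le> energy_budget" using tot minimum[of "q t"] by linarith
qed

lemma q_bounded: "\<exists>R. \<forall>t\<ge>0. norm (q t) \<le> R"
proof -
  obtain \<mu> where \<mu>: "\<mu> > 0" "\<And>x. norm x \<ge> 1 \<Longrightarrow> \<mu> * norm x \<le> H x - H 0"
    using strictly_convex_coercive[OF convex minimum H_continuous] by blast
  have "norm (q t) \<le> max 1 (energy_budget / \<mu>)" if "t \<ge> 0" for t
  proof (cases "norm (q t) \<ge> 1")
    case True
    then have "\<mu> * norm (q t) \<le> energy_budget" using \<mu>(2) lyapunov_parts_bounded(1)[OF that] by force
    then show ?thesis using \<mu>(1) by (simp add: field_simps le_max_iff_disj)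
  qed auto
  then show ?thesis by blast
qed

text \<open>
  As \<open>z\<^sub>i \<plusminus> \<rho>\<close> still lies in the interval, the \<open>i\<close>-th term of the Lyapunov function grows at least like
  \<open>\<rho> \<bar>c\<^sub>i\<bar>\<close>.
\<close>

lemma c_tree_bounded:
  assumes "i \<in> T"
  shows "\<exists>R. \<forall>t\<ge>0. \<bar>c t $ i\<bar> \<le> R"
proof -
  define \<rho> where "\<rho> = min (z $ i - um $ i) (up $ i - z $ i)"
  have \<rho>: "\<rho> > 0" "z $ i + \<rho> \<in> {um $ i..up $ i}" "z $ i - \<rho> \<in> {um $ i..up $ i}"
    using interior[OF assms] by (auto simp: \<rho>_def)
  define C where "C = energy_budget + (z $ i + \<rho>)\<^sup>2 / 2 + (z $ i - \<rho>)\<^sup>2 / 2"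
  have "\<bar>c t $ i\<bar> \<le> C / \<rho>" if "t \<ge> 0" for t
  proof -
    have "- c t $ i * (z $ i + \<rho>) - (z $ i + \<rho>)\<^sup>2 / 2 + z $ i * c t $ i \<le> energy_budget"
      using clip_primitive_ge[OF \<rho>(2), of "- c t $ i"] lyapunov_parts_bounded(2)[OF that, of i] by linarith
    then have "- c t $ i * \<rho> \<le> energy_budget + (z $ i + \<rho>)\<^sup>2 / 2" by (simp add: algebra_simps)
    moreover have "- c t $ i * (z $ i - \<rho>) - (z $ i - \<rho>)\<^sup>2 / 2 + z $ i * c t $ i \<le> energy_budget"
      using clip_primitive_ge[OF \<rho>(3), of "- c t $ i"] lyapunov_parts_bounded(2)[OF that, of i] by linarith
    then have "c t $ i * \<rho> \<le> energy_budget + (z $ i - \<rho>)\<^sup>2 / 2" by (simp add: algebra_simps)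
    moreover have "0 \<le> (z $ i + \<rho>)\<^sup>2 / 2" "0 \<le> (z $ i - \<rho>)\<^sup>2 / 2" by auto
    ultimately have "- c t $ i * \<rho> \<le> C" "c t $ i * \<rho> \<le> C" unfolding C_def by linarith+
    then have "\<bar>c t $ i\<bar> * \<rho> \<le> C" by (auto simp: abs_if)
    then show ?thesis using \<rho>(1) by (simp add: field_simps)
  qed
  then show ?thesis by blast
qed

text \<open>
  If \<open>h\<close> reroutes edge \<open>e\<close> through \<open>T\<close>, then \<open>c\<^sub>e - h \<bullet> c\<close> is constant: its derivative is the inner product of a
  circulation and a tension.
\<close>

lemma c_nth_bounded: "\<exists>R. \<forall>t\<ge>0. \<bar>c t $ e\<bar> \<le> R"
proof -
  obtain R where R: "\<And>i t. i \<in> T \<Longrightarrow> t \<ge> 0 \<Longrightarrow> \<bar>c t $ i\<bar> \<le> R i" using c_tree_bounded by metis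
  obtain h where h: "\<And>i. i \<notin> T \<Longrightarrow> h $ i = 0" "B *v h = B *v axis e 1"
    using connected_flow_supported[OF graph connected, of e] by blast
  let ?k = "axis e 1 - h"
  have "B *v ?k = 0" using h(2) by (simp add: matrix_vector_mult_diff_distrib)
  have "((\<lambda>t. ?k \<bullet> c t) has_vector_derivative 0) (at t within {0..})" if "t \<in> {0..}" for t
  proof -
    have "((\<lambda>t. ?k \<bullet> c t) has_vector_derivative ?k \<bullet> tension (q t)) (at t within {0..})"
      using that by (intro bounded_linear.has_vector_derivative[OF bounded_linear_inner_right] c_der) auto
    moreover have "?k \<bullet> tension (q t) = gradient H (q t) \<bullet> (B *v ?k)"
      by (subst inner_matrix_transpose) (rule inner_commute)
    ultimately show ?thesis using \<open>B *v ?k = 0\<close> by simp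
  qed
  then obtain k0 where k0: "\<And>t. t \<in> {0..} \<Longrightarrow> ?k \<bullet> c t = k0"
    using has_vector_derivative_zero_constant[of "{0..}" "\<lambda>t. ?k \<bullet> c t"] by auto
  have "\<bar>c t $ e\<bar> \<le> \<bar>k0\<bar> + (\<Sum>i\<in>UNIV. \<bar>h $ i\<bar> * R i)" if "t \<ge> 0" for t
  proof -
    have "c t $ e = k0 + h \<bullet> c t" using k0[of t] that by (simp add: inner_diff_left inner_axis')
    moreover have "\<bar>h \<bullet> c t\<bar> \<le> (\<Sum>i\<in>UNIV. \<bar>h $ i\<bar> * R i)"
      unfolding inner_vec_def
    proof (rule order_trans[OF sum_abs], rule sum_mono)
      fix i show "\<bar>h $ i \<bullet> c t $ i\<bar> \<le> \<bar>h $ i\<bar> * R i"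
        using R[of i t] h(1)[of i] that by (cases "i \<in> T") (auto simp: abs_mult intro: mult_left_mono)
    qed
    ultimately show ?thesis by linarith
  qed
  then show ?thesis by blast
qed

lemma c_bounded: "\<exists>R. \<forall>t\<ge>0. norm (c t) \<le> R"
proof -
  obtain R where R: "\<And>i t. t \<ge> 0 \<Longrightarrow> \<bar>c t $ i\<bar> \<le> R i" using c_nth_bounded by metis
  have "norm (c t) \<le> (\<Sum>i\<in>UNIV. R i)" if "t \<ge> 0" for t
    by (rule order_trans[OF norm_le_l1_cart]) (intro sum_mono R that)
  then show ?thesis by blast
qed

lemma state_in_compact: "\<exists>K. compact K \<and> (\<forall>t\<ge>0. (q t, c t) \<in> K)"
proof -
  obtain R1 R2 where "\<And>t. t \<ge> 0 \<Longrightarrow> norm (q t) \<le> R1" "\<And>t. t \<ge> 0 \<Longrightarrow> norm (c t) \<le> R2"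
    using q_bounded c_bounded by blast
  then show ?thesis by (intro exI[of _ "cball 0 R1 \<times> cball 0 R2"]) (auto intro: compact_Times)
qed

lemma state_der:
  assumes "0 \<le> t"
  shows "((\<lambda>t. (q t, c t)) has_vector_derivative (B *v g (- tension (q t) - c t), tension (q t))) (at t within {0..})"
  by (rule has_vector_derivative_Pair[OF q_der[OF assms] c_der[OF assms]])

text \<open>
  The trajectory is Lipschitz, as it stays in a compact set and the vector field is continuous.
\<close>

lemma uniformly_continuous_along:
  fixes F :: "(real^'v) \<times> (real^'e) \<Rightarrow> real"
  assumes "continuous_on UNIV F"
  shows "uniformly_continuous_on {0..} (\<lambda>t. F (q t, c t))"
proof -
  obtain K where K: "compact K" "\<And>t. t \<ge> 0 \<Longrightarrow> (q t, c t) \<in> K" using state_in_compact by blast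
  let ?f = "\<lambda>s. (B *v g (- tension (fst s) - snd s), tension (fst s))"
  have "continuous_on K ?f"
    by (intro continuous_intros continuous_mult_vec continuous_g continuous_gradient
        continuous_on_fst continuous_on_snd continuous_on_id)
  then have "bounded (?f ` K)" using K(1) by (intro compact_imp_bounded compact_continuous_image)
  then obtain M where M: "\<And>s. s \<in> K \<Longrightarrow> norm (?f s) \<le> M" by (auto simp: bounded_iff)
  have M_nonneg: "0 \<le> M" using order_trans[OF norm_ge_zero M[OF K(2)[of 0]]] by simp
  have lip: "dist (q (t + \<tau>), c (t + \<tau>)) (q t, c t) \<le> M * \<tau>" if "t \<ge> 0" "\<tau> \<ge> 0" for t \<tau>
  proof -
    have "norm ((q (t + \<tau>), c (t + \<tau>)) - (q t, c t) - \<tau> *\<^sub>R 0) \<le> M * \<tau>"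
      by (rule norm_increment_bound[OF state_der]) (use that M K(2) in auto)
    then show ?thesis by (simp add: dist_norm)
  qed
  have "M-lipschitz_on {0..} (\<lambda>t. (q t, c t))"
  proof (rule lipschitz_onI)
    fix s t :: real assume "s \<in> {0..}" "t \<in> {0..}"
    then show "dist (q s, c s) (q t, c t) \<le> M * dist s t"
      using lip[of s "t - s"] lip[of t "s - t"] by (cases "s \<le> t") (auto simp: dist_commute dist_real_def)
  qed (rule M_nonneg)
  then have "uniformly_continuous_on {0..} (\<lambda>t. (q t, c t))" by (rule lipschitz_on_uniformly_continuous)
  moreover have "uniformly_continuous_on K F"
    by (rule compact_uniformly_continuous[OF continuous_on_subset[OF assms subset_UNIV] K(1)])
  then have "uniformly_continuous_on ((\<lambda>t. (q t, c t)) ` {0..}) F"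
    using image_subsetI[of "{0..}" "\<lambda>t. (q t, c t)" K] K(2)
    unfolding uniformly_continuous_on_def by (meson atLeast_iff subsetD)
  ultimately show ?thesis by (rule uniformly_continuous_on_compose)
qed

text \<open>
  Barbalat's lemma for the Lyapunov function, which decreases to a limit.
\<close>

lemma dissipation_tendsto_zero: "((\<lambda>t. dissipation i (q t, c t)) \<longlongrightarrow> 0) at_top"
proof -
  obtain L where "(lyapunov \<longlongrightarrow> L) at_top"
    using antimono_bounded_below_converges[where \<phi> = lyapunov, OF lyapunov_antimono lyapunov_lower] by auto
  moreover have "(lyapunov has_vector_derivative - (\<Sum>i\<in>UNIV. dissipation i (q t, c t))) (at t within {0..})"
    if "0 \<le> t" for t
    using lyapunov_der[OF that] by (simp add: has_real_derivative_iff_has_vector_derivative)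
  moreover have "uniformly_continuous_on {0..} (\<lambda>t. - (\<Sum>i\<in>UNIV. dissipation i (q t, c t)))"
    by (rule uniformly_continuous_along[of "\<lambda>s. - (\<Sum>i\<in>UNIV. dissipation i s)"])
       (intro continuous_on_minus continuous_on_sum continuous_dissipation)
  ultimately have "((\<lambda>t. - (\<Sum>i\<in>UNIV. dissipation i (q t, c t))) \<longlongrightarrow> 0) at_top"
    by (intro barbalat[where X = lyapunov and L = L])
  from tendsto_minus[OF this]
  have lim: "((\<lambda>t. \<Sum>i\<in>UNIV. dissipation i (q t, c t)) \<longlongrightarrow> 0) at_top"
    by simp
  show ?thesis
    by (rule tendsto_sandwich[OF _ _ tendsto_const lim])
       (auto intro!: always_eventually dissipation_nonneg member_le_sum)
qed

text \<open>
  The dissipation of an edge dominates the square of its gap.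
\<close>

lemma output_gap_tendsto_zero: "((\<lambda>t. g (- tension (q t) - c t) - g (- c t)) \<longlongrightarrow> 0) at_top"
proof (rule tendsto_zero_vec)
  fix i
  have "((\<lambda>t. sqrt (dissipation i (q t, c t))) \<longlongrightarrow> sqrt 0) at_top"
    by (intro tendsto_real_sqrt dissipation_tendsto_zero)
  then have lim: "((\<lambda>t. sqrt (dissipation i (q t, c t))) \<longlongrightarrow> 0) at_top" by simp
  show "((\<lambda>t. (g (- tension (q t) - c t) - g (- c t)) $ i) \<longlongrightarrow> 0) at_top"
  proof (rule Lim_null_comparison[OF _ lim])
    show "eventually (\<lambda>t. norm ((g (- tension (q t) - c t) - g (- c t)) $ i) \<le> sqrt (dissipation i (q t, c t))) at_top"
    proof (rule always_eventually, rule allI)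
      fix t
      show "norm ((g (- tension (q t) - c t) - g (- c t)) $ i) \<le> sqrt (dissipation i (q t, c t))"
        using dissipation_lower[of i "(q t, c t)"]
        by (intro real_le_rsqrt) (simp add: g_nth power2_commute minus_diff_commute[of "tension (q t) $ i"])
    qed
  qed
qed

text \<open>
  The saturation of \<open>-c\<^sub>i\<close> moves only while \<open>-c\<^sub>i\<close> is inside the interval, where small dissipation means
  that \<open>c\<^sub>i\<close> is slow or close to an end. Close to an end the saturated value itself may still be fast,
  so it is measured by \<open>clip_cubic\<close>, whose speed does tend to \<open>0\<close>.
\<close>

lemma g_integrator_slowly_varying: "slowly_varying (\<lambda>t. g (- c t))"
proof (rule slowly_varying_vec)
  fix i
  let ?a = "um $ i" and ?b = "up $ i"
  let ?\<psi> = "\<lambda>t. clip_cubic ?a ?b (- c t $ i)"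
  let ?k = "\<lambda>t. clip ?a ?b (- c t $ i)"
  let ?r = "\<lambda>t. (?k t - ?a) * (?b - ?k t) * (- tension (q t) $ i)"
  have der: "(?\<psi> has_vector_derivative ?r t) (at t within {0..})" if "t \<ge> 0" for t
    unfolding has_real_derivative_iff_has_vector_derivative[symmetric]
    by (intro DERIV_chain2[OF clip_cubic_derivative[OF bounds]] DERIV_minus c_nth_der that)
  let ?w = "\<lambda>t. dissipation i (q t, c t)"
  have "((\<lambda>t. (?b - ?a)\<^sup>2 * sqrt (?w t) + (?b - ?a) * ?w t) \<longlongrightarrow> (?b - ?a)\<^sup>2 * sqrt 0 + (?b - ?a) * 0) at_top"
    by (intro tendsto_intros dissipation_tendsto_zero)
  then have "((\<lambda>t. (?b - ?a)\<^sup>2 * sqrt (?w t) + (?b - ?a) * ?w t) \<longlongrightarrow> 0) at_top" by simp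
  moreover have "eventually (\<lambda>t. norm (?r t) \<le> (?b - ?a)\<^sup>2 * sqrt (?w t) + (?b - ?a) * ?w t) at_top"
  proof (rule always_eventually, rule allI)
    fix t show "norm (?r t) \<le> (?b - ?a)\<^sup>2 * sqrt (?w t) + (?b - ?a) * ?w t"
      using clip_cubic_rate_bound[OF bounds[of i], of "- c t $ i" "tension (q t) $ i"]
      by (simp add: dissipation_def abs_mult)
  qed
  ultimately have "(?r \<longlongrightarrow> 0) at_top" by (rule Lim_null_comparison[rotated])
  with der have slow: "slowly_varying ?\<psi>" by (rule slowly_varying_of_derivative_tendsto_zero)
  show "slowly_varying (\<lambda>t. g (- c t) $ i)"
    unfolding slowly_varying_def
  proof (intro allI impI)
    fix N \<epsilon> :: real assume "\<epsilon> > 0"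
    then have "eventually (\<lambda>t. \<forall>s\<in>{0..N}. dist (?\<psi> (t + s)) (?\<psi> t) < \<epsilon> ^ 3 / 6) at_top"
      using slow[unfolded slowly_varying_def, rule_format, of "\<epsilon> ^ 3 / 6" N] by simp
    then show "eventually (\<lambda>t. \<forall>s\<in>{0..N}. dist (g (- c (t + s)) $ i) (g (- c t) $ i) < \<epsilon>) at_top"
    proof eventually_elim
      case (elim t)
      show ?case
      proof
        fix s assume "s \<in> {0..N}"
        then have "\<bar>?k (t + s) - ?k t\<bar> ^ 3 < \<epsilon> ^ 3"
          using clip_cubic_separates[OF bounds[of i], of "- c (t + s) $ i" "- c t $ i"] elim
          by (force simp: dist_real_def)
        then have "\<bar>?k (t + s) - ?k t\<bar> < \<epsilon>" using \<open>\<epsilon> > 0\<close> by (auto intro: power_less_imp_less_base)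
        then show "dist (g (- c (t + s)) $ i) (g (- c t) $ i) < \<epsilon>" by (simp add: dist_real_def g_nth)
      qed
    qed
  qed
qed

lemma net_flow_tendsto_zero: "((\<lambda>t. B *v g (- tension (q t) - c t)) \<longlongrightarrow> 0) at_top"
proof -
  obtain R where R: "\<And>t. t \<ge> 0 \<Longrightarrow> norm (q t) \<le> R" using q_bounded by blast
  have "slowly_varying (\<lambda>t. g (- tension (q t) - c t))"
    by (rule slowly_varying_tendsto_zero_diff[OF g_integrator_slowly_varying output_gap_tendsto_zero])
  then have "slowly_varying (\<lambda>t. B *v g (- tension (q t) - c t))"
    by (rule slowly_varying_compose[where K = UNIV])
       (auto intro: bounded_linear.uniformly_continuous_on[OF matrix_vector_mul_bounded_linear uniformly_continuous_on_id])
  then show ?thesis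
    using q_der R by (intro bounded_slowly_varying_derivative_tendsto_zero)
qed

lemma tension_tendsto_zero: "((\<lambda>t. tension (q t)) \<longlongrightarrow> 0) at_top"
proof -
  obtain R1 R2 where R: "\<And>t. t \<ge> 0 \<Longrightarrow> norm (q t) \<le> R1" "\<And>t. t \<ge> 0 \<Longrightarrow> norm (c t) \<le> R2"
    using q_bounded c_bounded by blast
  have "slowly_varying q"
    using q_der net_flow_tendsto_zero by (rule slowly_varying_of_derivative_tendsto_zero)
  moreover have "uniformly_continuous_on (cball 0 R1) tension"
    by (intro compact_uniformly_continuous continuous_tension continuous_on_id) auto
  moreover have "eventually (\<lambda>t. q t \<in> cball 0 R1) at_top"
    using R(1) by (intro eventually_at_top_linorderI[of 0]) auto
  ultimately have "slowly_varying (\<lambda>t. tension (q t))" by (rule slowly_varying_compose)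
  then show ?thesis
    using c_der R(2) by (intro bounded_slowly_varying_derivative_tendsto_zero)
qed

lemma q_balanced:
  assumes "0 \<le> t"
  shows "1 \<bullet> q t = 0"
proof -
  have "((\<lambda>t. 1 \<bullet> q t) has_vector_derivative 0) (at t within {0..})" if "t \<in> {0..}" for t
    using bounded_linear.has_vector_derivative[OF bounded_linear_inner_right q_der, of t 1] that
    by (simp add: one_inner_incidence[OF graph])
  then obtain k where "\<And>t. t \<in> {0..} \<Longrightarrow> 1 \<bullet> q t = k"
    using has_vector_derivative_zero_constant[of "{0..}" "\<lambda>t. 1 \<bullet> q t"] by auto
  then show ?thesis using balanced assms by (metis atLeast_iff order_refl)
qed

text \<open>
  The gradient is constant over the connected vertex set, hence orthogonal to \<open>x\<close>, whereas
  \<open>gradient_inner_pos\<close> makes this inner product positive unless \<open>x = 0\<close>.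
\<close>

lemma zero_tension_imp_zero:
  assumes "tension x = 0" and "1 \<bullet> x = 0"
  shows "x = 0"
proof (rule ccontr)
  assume "x \<noteq> 0"
  let ?p = "gradient H x"
  have "?p $ head e = ?p $ tail e" for e
    using assms(1) transpose_incidence_nth[OF graph, of ?p e] by simp
  then have const: "?p $ v = ?p $ w" for v w by (rule connected_potential_constant[OF connected])
  fix v
  have "?p = ?p $ v *\<^sub>R 1" using const by (auto simp: vec_eq_iff)
  then have "?p \<bullet> x = ?p $ v * (1 \<bullet> x)" by (metis inner_scaleR_left)
  then show False
    using gradient_inner_pos[OF convex minimum differentiable \<open>x \<noteq> 0\<close>] assms(2) by simp
qed

lemma E_tot_nonempty: "E_tot tail head um up \<noteq> {}"
proof -
  have "g (- (- z)) = z" using z_in by (auto simp: vec_eq_iff g_nth clip_def)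
  then have "(0, - z) \<in> E_tot tail head um up" using circulation by (auto simp: E_tot_def)
  then show ?thesis by blast
qed

theorem converges: "converges_into (\<lambda>t. (q t, c t)) (E_tot tail head um up)"
  unfolding converges_into_def
proof (intro conjI E_tot_nonempty tendstoI)
  fix \<epsilon> :: real assume "\<epsilon> > 0"
  obtain K where K: "compact K" "\<And>t. t \<ge> 0 \<Longrightarrow> (q t, c t) \<in> K" using state_in_compact by blast
  let ?K = "K \<inter> {s. 1 \<bullet> fst s = 0}"
  let ?F = "\<lambda>s. (tension (fst s), B *v g (- snd s))"
  have "eventually (\<lambda>t. \<exists>s\<in>?K. ?F s = 0 \<and> dist (q t, c t) s < \<epsilon>) at_top"
  proof (rule compact_zero_set_attracts)
    show "compact ?K"
      using K(1) by (intro compact_Int_closed closed_Collect_eq continuous_intros)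
    show "continuous_on ?K ?F"
      by (intro continuous_intros continuous_mult_vec continuous_g continuous_gradient
          continuous_on_fst continuous_on_snd continuous_on_id)
    show "eventually (\<lambda>t. (q t, c t) \<in> ?K) at_top"
      using K(2) q_balanced by (intro eventually_at_top_linorderI[of 0]) auto
    have "((\<lambda>t. B *v g (- tension (q t) - c t) - B *v (g (- tension (q t) - c t) - g (- c t))) \<longlongrightarrow> 0 - B *v 0) at_top"
      by (intro tendsto_diff net_flow_tendsto_zero output_gap_tendsto_zero
          bounded_linear.tendsto[OF matrix_vector_mul_bounded_linear])
    then have "((\<lambda>t. B *v g (- c t)) \<longlongrightarrow> 0) at_top"
      by (simp add: matrix_vector_mult_diff_distrib)
    then show "((\<lambda>t. ?F (q t, c t)) \<longlongrightarrow> 0) at_top"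
      using tendsto_Pair[OF tension_tendsto_zero] by (simp add: zero_prod_def)
  qed fact
  then show "eventually (\<lambda>t. dist (infdist (q t, c t) (E_tot tail head um up)) 0 < \<epsilon>) at_top"
  proof eventually_elim
    case (elim t)
    then obtain x y where s: "1 \<bullet> x = 0" "tension x = 0" "B *v g (- y) = 0" "dist (q t, c t) (x, y) < \<epsilon>"
      by (auto simp: zero_prod_def)
    then have "(x, y) \<in> E_tot tail head um up" using zero_tension_imp_zero by (auto simp: E_tot_def)
    from infdist_le[OF this, of "(q t, c t)"] s(4) show ?case by (simp add: infdist_nonneg)
  qed
qed

end

section \<open>Existence of closed-loop trajectories\<close>

context flow_network
begin

lemma g_in_box: "g y \<in> {um..up}"
  using clip_in[OF bounds] by (auto simp: less_eq_vec_def g_nth)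

lemma g_fixes_box: "z \<in> {um..up} \<Longrightarrow> g z = z"
  by (auto simp: vec_eq_iff less_eq_vec_def g_nth clip_def)

lemma net_flow_bounded: "\<exists>C\<ge>0. \<forall>y. norm (B *v g y) \<le> C"
proof -
  have "compact {um..up}" by (simp add: interval_cbox_cart)
  from continuous_norm_bound_on_compact[OF this continuous_mult_vec[OF continuous_on_id], of B]
  obtain C where C: "\<And>w. w \<in> {um..up} \<Longrightarrow> norm (B *v w) \<le> C" by blast
  then have bound: "norm (B *v g y) \<le> C" for y using g_in_box by blast
  then have "0 \<le> C" using order_trans[OF norm_ge_zero bound[of 0]] by simp
  then show ?thesis using bound by blast
qed

text \<open>
  \<open>peano_global\<close> asks for a vector field that is bounded on bounded time intervals. The vertex flow is bounded by
  some \<open>C\<close>, so a trajectory from \<open>0\<close> stays within \<open>C t\<close> of it, and the field may be changed outside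
  the ball of radius \<open>R t = C t + 1\<close> by retracting \<open>q\<close> to that ball.
\<close>

theorem trajectory_exists:
  "\<exists>q c. q 0 = 0 \<and> (\<forall>t\<ge>0.
     (q has_vector_derivative B *v g (- tension (q t) - c t)) (at t within {0..}) \<and>
     (c has_vector_derivative tension (q t)) (at t within {0..}))"
proof -
  obtain C where C: "C \<ge> 0" "\<And>y. norm (B *v g y) \<le> C" using net_flow_bounded by blast
  define R where "R t = C * t + 1" for t
  have R: "R t > 0" if "t \<ge> 0" for t using C(1) that by (simp add: R_def add_nonneg_pos)
  define pr where "pr t x = (R t / max (R t) (norm x)) *\<^sub>R x" for t and x :: "real^'v"
  have pr_norm: "norm (pr t x) \<le> R t" if "t \<ge> 0" for t x
  proof -
    have "norm (pr t x) = R t * (norm x / max (R t) (norm x))"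
      using R[OF that] by (simp add: pr_def)
    also have "\<dots> \<le> R t * 1" using R[OF that] by (intro mult_left_mono) (auto simp: divide_le_eq)
    finally show ?thesis by simp
  qed
  have pr_id: "pr t x = x" if "norm x \<le> R t" "t \<ge> 0" for t x
    using that R[of t] by (simp add: pr_def max_absorb1)
  define f where "f t s = (B *v g (- tension (pr t (fst s)) - snd s), tension (pr t (fst s)))"
    for t and s :: "(real^'v) \<times> (real^'e)"
  have cont_pr: "continuous_on ({0..} \<times> UNIV) (\<lambda>w::real \<times> (real^'v) \<times> (real^'e). pr (fst w) (fst (snd w)))"
    unfolding pr_def R_def
  proof (intro continuous_intros ballI)
    fix w :: "real \<times> (real^'v) \<times> (real^'e)" assume "w \<in> {0..} \<times> UNIV"
    then show "max (C * fst w + 1) (norm (fst (snd w))) \<noteq> 0" using R[of "fst w"] by (auto simp: R_def)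
  qed
  have "\<exists>X. X 0 = (0, 0) \<and> (\<forall>t\<ge>0. (X has_vector_derivative f t (X t)) (at t within {0..}))"
  proof (rule peano_global)
    have "continuous_on ({0..} \<times> UNIV) (\<lambda>w::real \<times> (real^'v) \<times> (real^'e). f (fst w) (snd w))"
      unfolding f_def
      by (intro continuous_on_Pair continuous_mult_vec continuous_g continuous_on_diff continuous_on_minus
          continuous_gradient cont_pr continuous_on_snd continuous_on_id)
    then show "continuous_on ({0..} \<times> UNIV) (\<lambda>(t, s). f t s)" by (simp add: case_prod_beta')
  next
    fix T :: real
    obtain M where M: "\<And>x. x \<in> cball 0 (R T) \<Longrightarrow> norm (tension x) \<le> M"
      using continuous_norm_bound_on_compact[OF compact_cball continuous_tension[OF continuous_on_id], of 0 "R T"]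
      by blast
    have "norm (f t s) \<le> C + M" if "t \<in> {0..T}" for t s
    proof -
      have "R t \<le> R T" using that C(1) by (auto simp: R_def intro: mult_left_mono)
      then have "norm (tension (pr t (fst s))) \<le> M" using pr_norm[of t "fst s"] that by (intro M) auto
      then show ?thesis unfolding f_def using C(2) by (intro order_trans[OF norm_Pair_le] add_mono) auto
    qed
    then show "\<exists>M. \<forall>t\<in>{0..T}. \<forall>s. norm (f t s) \<le> M" by blast
  qed
  then obtain X where X: "X 0 = (0, 0)"
    "\<And>t. t \<ge> 0 \<Longrightarrow> (X has_vector_derivative f t (X t)) (at t within {0..})" by blast
  have q_der: "((\<lambda>t. fst (X t)) has_vector_derivative fst (f t (X t))) (at t within {0..})" if "t \<ge> 0" for t
    by (rule bounded_linear.has_vector_derivative[OF bounded_linear_fst X(2)[OF that]])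
  have c_der: "((\<lambda>t. snd (X t)) has_vector_derivative snd (f t (X t))) (at t within {0..})" if "t \<ge> 0" for t
    by (rule bounded_linear.has_vector_derivative[OF bounded_linear_snd X(2)[OF that]])
  have inside: "pr t (fst (X t)) = fst (X t)" if "t \<ge> 0" for t
  proof -
    have "norm (fst (X (0 + t)) - fst (X 0) - t *\<^sub>R 0) \<le> C * t"
      by (rule norm_increment_bound[OF q_der]) (use that C(2) in \<open>auto simp: f_def\<close>)
    then show ?thesis using that X(1) by (intro pr_id) (auto simp: R_def)
  qed
  show ?thesis
    by (intro exI[of _ "\<lambda>t. fst (X t)"] exI[of _ "\<lambda>t. snd (X t)"])
       (use X(1) q_der c_der inside in \<open>auto simp: f_def\<close>)
qed

section \<open>A drifting trajectory without the interior point condition\<close>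

definition circulations where "circulations = {z \<in> {um..up}. B *v z = 0}"

definition interior_edges where "interior_edges z = {i. um $ i < z $ i \<and> z $ i < up $ i}"

lemma circulation_bounds:
  assumes "z \<in> circulations"
  shows "um $ i \<le> z $ i" "z $ i \<le> up $ i"
  using assms by (auto simp: circulations_def less_eq_vec_def)

lemma E_tot_empty: "circulations = {} \<Longrightarrow> E_tot tail head um up = {}"
  using g_in_box by (auto simp: E_tot_def circulations_def)

text \<open>
  An edge that is interior for one of two circulations is interior for their midpoint. So a
  circulation with the largest number of interior edges has the largest set of them.
\<close>

lemma circulation_maximal_interior:
  assumes "circulations \<noteq> {}"
  shows "\<exists>z\<in>circulations. \<forall>z'\<in>circulations. interior_edges z' \<subseteq> interior_edges z"
proof -
  obtain z0 where z0: "z0 \<in> circulations" using assms by blast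
  have "\<forall>z. z \<in> circulations \<longrightarrow> card (interior_edges z) < Suc CARD('e)"
    by (simp add: less_Suc_eq_le card_mono)
  from ex_has_greatest_nat[of "\<lambda>z. z \<in> circulations", OF z0 this] obtain z where z: "z \<in> circulations"
    "\<And>z'. z' \<in> circulations \<Longrightarrow> card (interior_edges z') \<le> card (interior_edges z)"
    by blast
  have "interior_edges z' \<subseteq> interior_edges z" if "z' \<in> circulations" for z'
  proof -
    let ?m = "(1 / 2) *\<^sub>R z + (1 / 2) *\<^sub>R z'"
    have b: "um $ i \<le> z $ i" "z $ i \<le> up $ i" "um $ i \<le> z' $ i" "z' $ i \<le> up $ i" for i
      using circulation_bounds z(1) that by auto
    have "B *v ?m = 0" using z(1) that
      by (simp add: circulations_def matrix_vector_right_distrib matrix_vector_mult_scaleR)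
    moreover have "um $ i \<le> ?m $ i" "?m $ i \<le> up $ i" for i using b[of i] by auto
    ultimately have "?m \<in> circulations" by (auto simp: circulations_def less_eq_vec_def)
    moreover have "interior_edges z \<union> interior_edges z' \<subseteq> interior_edges ?m"
    proof
      fix i assume "i \<in> interior_edges z \<union> interior_edges z'"
      then show "i \<in> interior_edges ?m" using b[of i] by (auto simp: interior_edges_def)
    qed
    ultimately have "card (interior_edges z \<union> interior_edges z') \<le> card (interior_edges z)"
      using z(2)[of ?m] card_mono[of "interior_edges ?m"] by (meson finite order_trans)
    then have "interior_edges z = interior_edges z \<union> interior_edges z'"
      by (intro card_seteq) auto
    then show ?thesis by blast
  qed
  with z(1) show ?thesis by blast
qed

text \<open>
  The tangent cone of the box at \<open>z\<close>; where the interval of an edge is a point, it forces \<open>h $ i = 0\<close>.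
\<close>

definition feasible_directions where
  "feasible_directions z = {h. \<forall>i. (z $ i = um $ i \<longrightarrow> 0 \<le> h $ i) \<and> (z $ i = up $ i \<longrightarrow> h $ i \<le> 0)}"

lemma circulation_push:
  assumes z: "z \<in> circulations" and h: "h \<in> feasible_directions z" "B *v h = 0"
  shows "\<exists>z'\<in>circulations. {i. h $ i \<noteq> 0} \<subseteq> interior_edges z'"
proof -
  have "eventually (\<lambda>\<epsilon>. um $ i \<le> z $ i + \<epsilon> * h $ i \<and> z $ i + \<epsilon> * h $ i \<le> up $ i \<and>
      (h $ i \<noteq> 0 \<longrightarrow> um $ i < z $ i + \<epsilon> * h $ i \<and> z $ i + \<epsilon> * h $ i < up $ i)) (at_right 0)" for i
  proof (cases "h $ i = 0")
    case True
    then show ?thesis using circulation_bounds[OF z] by simp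
  next
    case False
    have lim: "((\<lambda>\<epsilon>. z $ i + \<epsilon> * h $ i) \<longlongrightarrow> z $ i) (at_right 0)"
      by (auto intro!: tendsto_eq_intros)
    have b: "um $ i \<le> z $ i" "z $ i \<le> up $ i" using circulation_bounds[OF z] by auto
    have sg: "z $ i = um $ i \<Longrightarrow> 0 < h $ i" "z $ i = up $ i \<Longrightarrow> h $ i < 0"
      using h(1) False by (auto simp: feasible_directions_def less_le)
    have low: "eventually (\<lambda>\<epsilon>. um $ i < z $ i + \<epsilon> * h $ i) (at_right 0)"
    proof (cases "z $ i = um $ i")
      case True
      then show ?thesis using sg by (auto simp: eventually_at_right_less intro: eventually_mono[OF eventually_at_right_less])
    next
      case False
      then show ?thesis using b by (intro order_tendstoD(1)[OF lim]) auto
    qed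
    have high: "eventually (\<lambda>\<epsilon>. z $ i + \<epsilon> * h $ i < up $ i) (at_right 0)"
    proof (cases "z $ i = up $ i")
      case True
      then show ?thesis using sg
        by (auto simp: mult_pos_neg intro: eventually_mono[OF eventually_at_right_less])
    next
      case False
      then show ?thesis using b by (intro order_tendstoD(2)[OF lim]) auto
    qed
    from low high show ?thesis by eventually_elim auto
  qed
  then have "eventually (\<lambda>\<epsilon>. \<forall>i. um $ i \<le> z $ i + \<epsilon> * h $ i \<and> z $ i + \<epsilon> * h $ i \<le> up $ i \<and>
      (h $ i \<noteq> 0 \<longrightarrow> um $ i < z $ i + \<epsilon> * h $ i \<and> z $ i + \<epsilon> * h $ i < up $ i)) (at_right (0::real))"
    by (rule eventually_all_finite)
  then obtain \<epsilon> where \<epsilon>: "\<And>i. um $ i \<le> z $ i + \<epsilon> * h $ i \<and> z $ i + \<epsilon> * h $ i \<le> up $ i \<and>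
      (h $ i \<noteq> 0 \<longrightarrow> um $ i < z $ i + \<epsilon> * h $ i \<and> z $ i + \<epsilon> * h $ i < up $ i)"
    using eventually_happens'[OF trivial_limit_at_right_real] by blast
  have "B *v (z + \<epsilon> *\<^sub>R h) = 0"
    using z h(2) by (simp add: circulations_def matrix_vector_right_distrib matrix_vector_mult_scaleR)
  then show ?thesis
    using \<epsilon> by (intro bexI[of _ "z + \<epsilon> *\<^sub>R h"])
      (auto simp: circulations_def interior_edges_def less_eq_vec_def)
qed

text \<open>
  Pairs \<open>(a, b)\<close> such that flow can be pushed from \<open>a\<close> to \<open>b\<close>, by raising the value of an edge or by
  lowering the value of an edge in the opposite direction.
\<close>

definition residual_arcs where
  "residual_arcs z = {(a, b). \<exists>e. (tail e = a \<and> head e = b \<and> z $ e < up $ e) \<or>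
                                   (tail e = b \<and> head e = a \<and> um $ e < z $ e)}"

lemma residual_path_direction:
  assumes "(v, w) \<in> (residual_arcs z)\<^sup>*"
  shows "\<exists>h\<in>feasible_directions z. B *v h = axis w 1 - axis v 1"
  using assms
proof (rule path_flow)
  fix a b assume "(a, b) \<in> residual_arcs z"
  then obtain e where "(tail e = a \<and> head e = b \<and> z $ e < up $ e) \<or> (tail e = b \<and> head e = a \<and> um $ e < z $ e)"
    unfolding residual_arcs_def by blast
  then show "\<exists>h\<in>feasible_directions z. B *v h = axis b 1 - axis a 1"
  proof
    assume "tail e = a \<and> head e = b \<and> z $ e < up $ e"
    then show ?thesis
      by (intro bexI[of _ "axis e 1"]) (auto simp: incidence_axis[OF graph] feasible_directions_def, auto simp: axis_def)
  next
    assume "tail e = b \<and> head e = a \<and> um $ e < z $ e"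
    then show ?thesis
      by (intro bexI[of _ "- axis e 1"])
         (auto simp: incidence_axis[OF graph] vec.neg feasible_directions_def, auto simp: axis_def)
  qed
qed (auto simp: feasible_directions_def add_nonneg_nonneg add_nonpos_nonpos)

text \<open>
  An edge at a bound of a proper interval would close, with a residual path, a circulation direction
  that moves its value into the interior, against maximality. So all edges with a proper interval are
  interior, and every residual arc runs along such an edge.
\<close>

lemma strongly_connected_residual_imp_interior_connected:
  assumes z: "z \<in> circulations" and max: "\<And>z'. z' \<in> circulations \<Longrightarrow> interior_edges z' \<subseteq> interior_edges z"
    and strong: "\<And>v w. (v, w) \<in> (residual_arcs z)\<^sup>*"
  shows "undirected_connected tail head (interior_edges z)"
proof -
  have inner: "e \<in> interior_edges z" if "um $ e < up $ e" for e
  proof (rule ccontr)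
    assume "e \<notin> interior_edges z"
    then have "z $ e = um $ e \<or> z $ e = up $ e"
      using circulation_bounds[OF z, of e] by (auto simp: interior_edges_def)
    then have "\<exists>h\<in>feasible_directions z. B *v h = 0 \<and> h $ e \<noteq> 0"
    proof
      assume low: "z $ e = um $ e"
      obtain h where h: "h \<in> feasible_directions z" "B *v h = axis (tail e) 1 - axis (head e) 1"
        using residual_path_direction[OF strong] by blast
      have "0 \<le> h $ e" using h(1) low by (simp add: feasible_directions_def)
      then have "(h + axis e 1) $ e \<noteq> 0" by (simp add: axis_def)
      moreover have "h + axis e 1 \<in> feasible_directions z"
        using h(1) low that by (auto simp: feasible_directions_def axis_def)
      moreover have "B *v (h + axis e 1) = 0"
        using h(2) by (simp add: matrix_vector_right_distrib incidence_axis[OF graph])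
      ultimately show ?thesis by blast
    next
      assume high: "z $ e = up $ e"
      obtain h where h: "h \<in> feasible_directions z" "B *v h = axis (head e) 1 - axis (tail e) 1"
        using residual_path_direction[OF strong] by blast
      have "h $ e \<le> 0" using h(1) high by (simp add: feasible_directions_def)
      then have "(h - axis e 1) $ e \<noteq> 0" by (simp add: axis_def)
      moreover have "h - axis e 1 \<in> feasible_directions z"
        using h(1) high that by (auto simp: feasible_directions_def axis_def)
      moreover have "B *v (h - axis e 1) = 0"
        using h(2) by (simp add: matrix_vector_mult_diff_distrib incidence_axis[OF graph])
      ultimately show ?thesis by blast
    qed
    then obtain h where "h \<in> feasible_directions z" "B *v h = 0" "h $ e \<noteq> 0" by blast
    with circulation_push[OF z] obtain z' where "z' \<in> circulations" "e \<in> interior_edges z'" by blast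
    then show False using max \<open>e \<notin> interior_edges z\<close> by blast
  qed
  have "residual_arcs z \<subseteq> {(a, b). \<exists>e\<in>interior_edges z. joins tail head e a b}"
  proof safe
    fix a b assume "(a, b) \<in> residual_arcs z"
    then obtain e where e: "joins tail head e a b" "z $ e < up $ e \<or> um $ e < z $ e"
      by (auto simp: residual_arcs_def joins_def)
    then have "e \<in> interior_edges z" using circulation_bounds[OF z, of e] by (intro inner) auto
    with e(1) show "\<exists>e\<in>interior_edges z. joins tail head e a b" by blast
  qed
  from rtrancl_mono[OF this] show ?thesis using strong by (auto simp: undirected_connected_def)
qed

lemma attains_minimum_on_closed:
  assumes "closed A" "A \<noteq> {}"
  shows "\<exists>x\<in>A. \<forall>y\<in>A. H x \<le> H y"
proof -
  obtain a where a: "a \<in> A" using assms(2) by blast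
  obtain \<mu> where \<mu>: "\<mu> > 0" "\<And>x. norm x \<ge> 1 \<Longrightarrow> \<mu> * norm x \<le> H x - H 0"
    using strictly_convex_coercive[OF convex minimum H_continuous] by blast
  let ?K = "A \<inter> {y. H y \<le> H a}"
  have "norm y \<le> max 1 ((H a - H 0) / \<mu>)" if "y \<in> ?K" for y
  proof (cases "norm y \<ge> 1")
    case True
    then have "\<mu> * norm y \<le> H a - H 0" using \<mu>(2)[of y] that by force
    then show ?thesis using \<mu>(1) by (simp add: field_simps le_max_iff_disj)
  qed auto
  then have "bounded ?K" by (auto simp: bounded_iff)
  moreover have "closed ?K"
    by (intro closed_Int assms(1) closed_Collect_le H_continuous continuous_on_const)
  ultimately have "compact ?K" by (simp add: compact_eq_bounded_closed)
  moreover have "?K \<noteq> {}" using a by auto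
  ultimately obtain x where x: "x \<in> ?K" "\<And>y. y \<in> ?K \<Longrightarrow> H x \<le> H y"
    using continuous_attains_inf[of ?K H] continuous_on_subset[OF H_continuous] by (metis subset_UNIV)
  have "H x \<le> H y" if "y \<in> A" for y
    using x that by (cases "H y \<le> H a") (auto intro: order_trans)
  then show ?thesis using x(1) by blast
qed

text \<open>
  Minimizing \<open>H\<close> with prescribed masses on \<open>U\<close> and on its complement leaves all exchanges of mass
  within either part free, so the gradient is constant on each. The inner product of \<open>x\<close> and its
  gradient is then \<open>\<alpha> - \<beta>\<close>, which is positive.
\<close>

lemma two_level_gradient:
  assumes "v0 \<in> U" "w0 \<notin> U"
  shows "\<exists>x \<alpha> \<beta>. x \<noteq> 0 \<and> 1 \<bullet> x = 0 \<and> \<beta> < \<alpha> \<and> (\<forall>i. gradient H x $ i = (if i \<in> U then \<alpha> else \<beta>))"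
proof -
  define u :: "real^'v" where "u = (\<chi> i. if i \<in> U then 1 else 0)"
  define A where "A = {x. u \<bullet> x = 1 \<and> 1 \<bullet> x = 0}"
  have "closed A" unfolding A_def
    by (intro closed_Collect_conj closed_Collect_eq continuous_intros)
  moreover have "axis v0 1 - axis w0 1 \<in> A"
    using assms by (simp add: A_def u_def inner_diff_right inner_axis)
  ultimately obtain x where x: "x \<in> A" "\<And>y. y \<in> A \<Longrightarrow> H x \<le> H y"
    using attains_minimum_on_closed[of A] by blast
  have eq: "gradient H x $ i = gradient H x $ j" if "i \<in> U \<longleftrightarrow> j \<in> U" for i j
  proof -
    let ?h = "axis i 1 - axis j (1::real)"
    have "((\<lambda>s. x + s *\<^sub>R ?h) has_derivative (\<lambda>s. s *\<^sub>R ?h)) (at (0::real))"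
      by (auto intro!: derivative_eq_intros)
    then have "((\<lambda>s. H (x + s *\<^sub>R ?h)) has_derivative (\<lambda>s. gradient H x \<bullet> (s *\<^sub>R ?h))) (at 0)"
      using has_derivative_compose[of "\<lambda>s. x + s *\<^sub>R ?h" "\<lambda>s. s *\<^sub>R ?h" 0 UNIV H "(\<bullet>) (gradient H x)"]
        has_derivative_gradient[OF differentiable, of x] by simp
    then have "((\<lambda>s. H (x + s *\<^sub>R ?h)) has_real_derivative gradient H x \<bullet> ?h) (at 0)"
      unfolding has_field_derivative_def by (rule has_derivative_eq_rhs) auto
    moreover have "H x \<le> H (x + s *\<^sub>R ?h)" for s
      using x(1) that by (intro x(2)) (simp add: A_def u_def inner_add_right inner_diff_right inner_axis)
    ultimately have "gradient H x \<bullet> ?h = 0"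
      by (intro DERIV_local_min[where d = 1]) auto
    then show ?thesis by (simp add: inner_diff_right inner_axis)
  qed
  define \<alpha> where "\<alpha> = gradient H x $ v0"
  define \<beta> where "\<beta> = gradient H x $ w0"
  have grad: "gradient H x $ i = (if i \<in> U then \<alpha> else \<beta>)" for i
    using eq[of i v0] eq[of i w0] assms by (auto simp: \<alpha>_def \<beta>_def)
  then have "gradient H x = (\<alpha> - \<beta>) *\<^sub>R u + \<beta> *\<^sub>R 1" by (simp add: vec_eq_iff u_def)
  then have "gradient H x \<bullet> x = \<alpha> - \<beta>" using x(1) by (simp add: A_def inner_add_left)
  moreover have "x \<noteq> 0" using x(1) by (auto simp: A_def)
  ultimately have "\<beta> < \<alpha>" using gradient_inner_pos[OF convex minimum differentiable, of x] by simp
  moreover have "1 \<bullet> x = 0" using x(1) by (simp add: A_def)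
  ultimately show ?thesis using grad \<open>x \<noteq> 0\<close> by blast
qed

text \<open>
  The tension of a gradient with levels \<open>\<alpha> > \<beta>\<close> on \<open>U\<close> and its complement vanishes off the cut. As no
  residual arc leaves \<open>U\<close>, edges out of \<open>U\<close> sit at their upper bound and have negative tension,
  edges into \<open>U\<close> sit at their lower bound and have positive tension. Hence \<open>c = -z + t d\<close>
  keeps the flow at \<open>z\<close>.
\<close>

theorem drifting_trajectory:
  assumes z: "z \<in> circulations" and max: "\<And>z'. z' \<in> circulations \<Longrightarrow> interior_edges z' \<subseteq> interior_edges z"
    and disconnected: "\<not> undirected_connected tail head (interior_edges z)"
  shows "\<exists>x c. x \<noteq> 0 \<and> 1 \<bullet> x = 0 \<and> (\<forall>t\<ge>0. B *v g (- tension x - c t) = 0 \<and>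
           (c has_vector_derivative tension x) (at t within {0..}))"
proof -
  obtain v0 w0 where "(v0, w0) \<notin> (residual_arcs z)\<^sup>*"
    using strongly_connected_residual_imp_interior_connected[OF z max] disconnected by blast
  define U where "U = (residual_arcs z)\<^sup>* `` {v0}"
  have "v0 \<in> U" "w0 \<notin> U" using \<open>(v0, w0) \<notin> (residual_arcs z)\<^sup>*\<close> by (auto simp: U_def)
  then obtain x \<alpha> \<beta> where x: "x \<noteq> 0" "1 \<bullet> x = 0" "\<beta> < \<alpha>"
    and grad: "\<And>i. gradient H x $ i = (if i \<in> U then \<alpha> else \<beta>)"
    using two_level_gradient by metis
  have closed: "b \<in> U" if "a \<in> U" "(a, b) \<in> residual_arcs z" for a b
    using that by (auto simp: U_def intro: rtrancl_into_rtrancl)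
  have d: "tension x $ e = (if head e \<in> U then \<alpha> else \<beta>) - (if tail e \<in> U then \<alpha> else \<beta>)" for e
    by (simp add: transpose_incidence_nth[OF graph] grad)
  define c where "c t = - z + t *\<^sub>R tension x" for t
  have "g (- tension x - c t) = z" if "t \<ge> 0" for t
    unfolding vec_eq_iff
  proof
    fix e
    have b: "um $ e \<le> z $ e" "z $ e \<le> up $ e" using circulation_bounds[OF z] by auto
    have arg: "(- tension x - c t) $ e = z $ e - (1 + t) * tension x $ e"
      by (simp add: c_def algebra_simps)
    consider "tail e \<in> U \<longleftrightarrow> head e \<in> U" | "tail e \<in> U" "head e \<notin> U" | "tail e \<notin> U" "head e \<in> U" by blast
    then show "g (- tension x - c t) $ e = z $ e"
    proof cases
      case 1
      then have "tension x $ e = 0" by (simp add: d)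
      then show ?thesis using b unfolding g_nth arg by (simp add: clip_def)
    next
      case 2
      then have "(tail e, head e) \<notin> residual_arcs z" using closed by blast
      then have "z $ e = up $ e" using b by (auto simp: residual_arcs_def)
      moreover have "(1 + t) * tension x $ e \<le> 0"
        using 2 x(3) that by (intro mult_nonneg_nonpos) (auto simp: d)
      ultimately show ?thesis using b unfolding g_nth arg by (simp add: clip_def)
    next
      case 3
      then have "(head e, tail e) \<notin> residual_arcs z" using closed by blast
      then have "z $ e = um $ e" using b by (auto simp: residual_arcs_def)
      moreover have "(1 + t) * tension x $ e \<ge> 0"
        using 3 x(3) that by (intro mult_nonneg_nonneg) (auto simp: d)
      ultimately show ?thesis using b unfolding g_nth arg by (simp add: clip_def)
    qed
  qed
  moreover have "B *v z = 0" using z by (simp add: circulations_def)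
  moreover have "(c has_vector_derivative tension x) (at t within {0..})" for t
    unfolding c_def by (auto intro!: derivative_eq_intros)
  ultimately show ?thesis using x(1,2) by auto
qed

lemma interior_point_conditionI:
  assumes "z \<in> circulations" "undirected_connected tail head (interior_edges z)"
  shows "interior_point_condition tail head um up"
proof -
  obtain T where "T \<subseteq> interior_edges z" "spanning_tree tail head T"
    using connected_contains_spanning_tree[OF assms(2)] by blast
  moreover have "interior_edges z = {i. z $ i \<in> interior {um $ i..up $ i}}"
    by (auto simp: interior_edges_def)
  ultimately show ?thesis
    using assms(1) unfolding interior_point_condition_def circulations_def
    by (intro bexI[of _ z]) (auto simp: g_fixes_box)
qed

section \<open>The equivalence\<close>

lemma constant_not_convergent:
  assumes "x \<noteq> 0"
  shows "\<not> converges_into (\<lambda>t. (x, c t)) (E_tot tail head um up)"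
proof
  assume conv: "converges_into (\<lambda>t. (x, c t)) (E_tot tail head um up)"
  then have ne: "E_tot tail head um up \<noteq> {}" by (simp add: converges_into_def)
  have "norm x \<le> infdist (x, c t) (E_tot tail head um up)" for t
    unfolding infdist_notempty[OF ne]
  proof (rule cINF_greatest[OF ne])
    fix s assume "s \<in> E_tot tail head um up"
    then have "fst s = 0" by (auto simp: E_tot_def)
    then show "norm x \<le> dist (x, c t) s" using dist_fst_le[of "(x, c t)" s] by simp
  qed
  then have "norm x \<le> 0"
    using conv unfolding converges_into_def by (intro tendsto_lowerbound[of _ 0 at_top]) auto
  then show False using assms by simp
qed

end

theorem corollary11:
  fixes tail head :: "'e::finite \<Rightarrow> 'v::finite"
    and um up :: "real^'e"
    and H :: "real^'v \<Rightarrow> real"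
    and x_star :: "real^'v"
  assumes "directed_graph tail head"
    and "compatible_constraints um up"
    and "strictly_convex H"
    and "twice_differentiable H"
    and "\<And>x. positive_definite (hessian H x)"
    and "\<And>x. H 0 \<le> H x"
  shows "(\<forall>x xc. x_star \<in> admissible_set (x 0) \<and>
              closed_loop_trajectory tail head H um up (\<lambda>t. x t - x_star) xc \<longrightarrow>
              converges_into (\<lambda>t. (x t - x_star, xc t)) (E_tot tail head um up))
         \<longleftrightarrow> interior_point_condition tail head um up"
    (is "?all \<longleftrightarrow> ?IPC")
proof -
  interpret flow_network tail head um up H
  proof
    show "continuous_on UNIV (gradient H)"
      using assms(4) unfolding twice_differentiable_def
      by (intro continuous_at_imp_continuous_on ballI differentiable_imp_continuous_within) auto
  qed (use assms in \<open>auto simp: compatible_constraints_def twice_differentiable_def\<close>)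
  show ?thesis
  proof
    assume ?IPC
    then obtain z T where z: "z \<in> {um..up}" "B *v z = 0" "spanning_tree tail head T"
      "T \<subseteq> {i. z $ i \<in> interior {um $ i..up $ i}}"
      unfolding interior_point_condition_def by auto
    show ?all
    proof (intro allI impI)
      fix x xc
      assume traj: "x_star \<in> admissible_set (x 0) \<and>
        closed_loop_trajectory tail head H um up (\<lambda>t. x t - x_star) xc"
      interpret closed_loop tail head um up H "\<lambda>t. x t - x_star" xc z T
        by standard
           (use traj z in \<open>auto simp: closed_loop_trajectory_def Let_def admissible_set_def inner_diff_right
              less_eq_vec_def spanning_tree_def\<close>)
      show "converges_into (\<lambda>t. (x t - x_star, xc t)) (E_tot tail head um up)" by (rule converges)
    qed
  next
    assume all: ?all
    have all': "converges_into (\<lambda>t. (q t, c t)) (E_tot tail head um up)"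
      if "1 \<bullet> q 0 = 0" "\<And>t. t \<ge> 0 \<Longrightarrow> (q has_vector_derivative B *v g (- tension (q t) - c t)) (at t within {0..})"
        "\<And>t. t \<ge> 0 \<Longrightarrow> (c has_vector_derivative tension (q t)) (at t within {0..})" for q c
      using all[rule_format, of "\<lambda>t. q t + x_star" c] that
      by (simp add: closed_loop_trajectory_def admissible_set_def inner_add_right)
    have "circulations \<noteq> {}"
    proof
      assume "circulations = {}"
      then have "E_tot tail head um up = {}" by (rule E_tot_empty)
      moreover obtain q c where "q 0 = 0"
        "\<And>t. t \<ge> 0 \<Longrightarrow> (q has_vector_derivative B *v g (- tension (q t) - c t)) (at t within {0..})"
        "\<And>t. t \<ge> 0 \<Longrightarrow> (c has_vector_derivative tension (q t)) (at t within {0..})"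
        using trajectory_exists by blast
      ultimately show False using all'[of q c] by (simp add: converges_into_def)
    qed
    then obtain z where z: "z \<in> circulations"
      "\<And>z'. z' \<in> circulations \<Longrightarrow> interior_edges z' \<subseteq> interior_edges z"
      using circulation_maximal_interior by blast
    show ?IPC
    proof (rule ccontr)
      assume "\<not> ?IPC"
      then have "\<not> undirected_connected tail head (interior_edges z)"
        using interior_point_conditionI z(1) by blast
      from drifting_trajectory[OF z this] obtain x c where x: "x \<noteq> 0" "1 \<bullet> x = 0"
        "\<And>t. t \<ge> 0 \<Longrightarrow> B *v g (- tension x - c t) = 0"
        "\<And>t. t \<ge> 0 \<Longrightarrow> (c has_vector_derivative tension x) (at t within {0..})" by blast
      have "converges_into (\<lambda>t. (x, c t)) (E_tot tail head um up)"
        by (rule all'[of "\<lambda>_. x"]) (use x in auto)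
      then show False using constant_not_convergent[OF x(1)] by blast
    qed
  qed
qed

end
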